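(* Let $\alpha\ge1$ and let $f_\alpha\colon S^1\to S^1$, $S^1=[0,1)$, be the intermittent map $$f_\alpha(x)=\begin{cases}x(1+2^\alpha x^\alpha)&x<1/2,\\2x-1&x\ge1/2.\end{cases}$$ Let $\psi\colon[0,\infty)\to\mathbb{R}$ be a monotonically decreasing function, let $\tilde x\in[0,1]$, and let $M_n(x)=\max\{\psi(d(f_\alpha^j(x),\tilde x)):0\le j<n\}$. Then for all $\varepsilon>0$ and Lebesgue almost all $x\in S^1$: (1) if $\tilde x=0$, then for all $n$ large enough $$\psi\left(\frac{(\log n)^{2+\varepsilon}}{n^{1/\alpha}}\right)\le M_n(x)\le\psi\left(\frac{1}{n^{1/\alpha}(\log n)^{2+\varepsilon}}\right);$$ (2) if $\tilde x\in(0,1]$, then for all $n$ large enough $$\psi\left(\frac{(\log n)^{4+\varepsilon}}{n^{1/\alpha}}\right)\le M_n(x)\le\psi\left(\frac{1}{n^{1/\alpha}(\log n)^{2+\varepsilon}}\right).$$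
   Context: $d(x,y)=|x-y|$ is the usual distance. *)

theory Defs
  imports "HOL-Analysis.Analysis"
begin

text \<open>The circle is modelled as the interval \<open>{0..<1}\<close> of reals, which the map below sends into
  itself whenever \<open>\<alpha> \<ge> 0\<close>; its values outside this interval play no role.\<close>

definition intermittent_map :: "real \<Rightarrow> real \<Rightarrow> real" where
  "intermittent_map \<alpha> x =
     (if x < 1/2 then x * (1 + 2 powr \<alpha> * x powr \<alpha>) else 2 * x - 1)"

text \<open>Meaningful for \<open>n \<ge> 1\<close> only, since the maximum of the empty set is unspecified. The distance
  is that of the real line, not the circle metric.\<close>

definition max_process :: "real \<Rightarrow> (real \<Rightarrow> real) \<Rightarrow> real \<Rightarrow> nat \<Rightarrow> real \<Rightarrow> real" where
  "max_process \<alpha> \<psi> p n x =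
     Max ((\<lambda>j. \<psi> (dist ((intermittent_map \<alpha> ^^ j) x) p)) ` {0..<n})"

end

theory Submission
  imports Defs "HOL-Real_Asymp.Real_Asymp"
begin

text \<open>
  Let \<open>d n\<close> be the least distance of the first \<open>n\<close> orbit points to \<open>p\<close>. Since \<open>\<psi>\<close> is decreasing, the
  maximum is \<open>\<psi> (d n)\<close>, so the claim is that almost surely \<open>d n\<close> equals \<open>n powr (-1/\<alpha>)\<close> up to powers
  of \<open>ln n\<close>. Both halves are shown along \<open>n = 2 ^ m\<close> by the Borel--Cantelli lemma, with error
  probabilities that are summable in \<open>m\<close>, and then transferred to all \<open>n\<close>.

  The single structural fact behind both halves is that the two branches of the map are increasing
  and convex. Their inverses are concave, and a concave function composed with increasing concave
  inverse branches is concave. So a set of initial points whose image under some iterate has a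
  concave distribution function, that is, a decreasing density, keeps this property under further
  iteration. This replaces invariant measures and distortion estimates: all comparisons of
  probabilities are comparisons of slopes of chords of concave functions. The intermittent fixed
  point enters only through the preimages \<open>grid k\<close> of 1 under the left branch, which decay like
  \<open>k powr (-1/\<alpha>)\<close> (\<open>grid_asymp\<close>).

  Orbits do not come too close (\<open>AE_distance_lower\<close>). The events that the orbit is in the leftmost
  part \<open>{1/2..<1/2 + grid n / 2}\<close> of the right half at time \<open>j\<close> are disjoint for \<open>j < n\<close>, because such
  a visit is followed by an excursion of \<open>n\<close> steps. As densities decrease, this bounds the expected
  number of visits to the right half before time \<open>n\<close> by \<open>1 / grid n\<close>, a multiple of
  \<open>n powr (1/\<alpha>)\<close>, and the expected number of visits to a short interval by its length times the same
  quantity. For \<open>p = 0\<close> one counts entrances to the neighbourhood instead of visits.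

  Orbits come close enough (\<open>AE_shrinking_targets\<close>). The map is accelerated to one full-branch map,
  \<open>induced\<close>, which performs a whole excursion in one step. Conditionally on the branches used
  in the first \<open>m\<close> steps, the image after \<open>m + 1\<close> steps has a density between two positive constants
  (\<open>next_measure_ge\<close>, \<open>next_measure_le\<close>). The upper bound and Markov's inequality show that
  \<open>N\<close> excursions are completed by time \<open>n\<close> up to probability of order \<open>N * ln n / n powr (1/\<alpha>)\<close>
  (\<open>elapsed_bound\<close>). The lower bound shows that a target of length \<open>l\<close> that is a union of cylinders of
  order \<open>q\<close> is missed in \<open>M\<close> blocks of \<open>q + 1\<close> excursions with probability at most \<open>(1 - c * l) ^ M\<close>
  (\<open>survival_bound\<close>). Next to \<open>p = 0\<close> there are targets of order 1; for \<open>p > 0\<close> the order has to grow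
  like \<open>ln n\<close> to resolve an interval next to \<open>p\<close>, which costs an additional logarithm.
\<close>

section \<open>Concave functions\<close>

text \<open>The slopes of the chords of a concave function decrease from left to right. The comparisons of
  measures below rest on this; the product form avoids excluding the chord with \<open>s = t\<close>.\<close>

lemma concave_on_slopes:
  fixes F :: "real \<Rightarrow> real"
  assumes F: "concave_on S F" and S: "a \<in> S" "t \<in> S" and o: "a < b" "b \<le> s" "s \<le> t"
  shows "(F t - F s) * (b - a) \<le> (F b - F a) * (t - s)"
proof (cases "s = t")
  case False
  have conv: "convex S" using F by (rule concave_on_imp_convex)
  have sub: "{a..t} \<subseteq> S"
    using conv S by (metis convex_contains_segment closed_segment_eq_real_ivl o order_trans less_imp_le)
  have cx: "convex_on S (\<lambda>x. - F x)" using F by (simp add: concave_on_def)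
  have slope: "(F w - F v) / (w - v) \<le> (F v - F u) / (v - u)" if "u < v" "v < w" "u \<in> S" "w \<in> S" for u v w
    using convex_on_slope_le[OF cx that(3,4,1,2)] that by (auto simp: field_simps)
  have "(F t - F s) / (t - s) \<le> (F b - F a) / (b - a)"
  proof (cases "b = s")
    case True then show ?thesis using slope[of a b t] o False S by auto
  next
    case neq: False
    have "(F t - F s) / (t - s) \<le> (F s - F b) / (s - b)"
      using slope[of b s t] o False neq S subsetD[OF sub, of b] by auto
    also have "\<dots> \<le> (F b - F a) / (b - a)"
      using slope[of a b s] o False neq S subsetD[OF sub, of s] by auto
    finally show ?thesis .
  qed
  then show ?thesis using o False by (simp add: field_simps)
qed simp

lemma concave_on_compose_mono:
  fixes F G :: "real \<Rightarrow> real"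
  assumes F: "concave_on T F" and G: "concave_on S G" and "G ` S \<subseteq> T" and mono: "mono_on T F"
  shows "concave_on S (\<lambda>x. F (G x))"
  unfolding concave_on_iff
proof (intro conjI ballI allI impI)
  show cS: "convex S" using G by (rule concave_on_imp_convex)
  fix x y u v :: real assume A: "x \<in> S" "y \<in> S" "0 \<le> u" "0 \<le> v" "u + v = 1"
  have cT: "convex T" using F by (rule concave_on_imp_convex)
  have inT: "G z \<in> T" if "z \<in> S" for z using that assms(3) by auto
  have "u * F (G x) + v * F (G y) \<le> F (u * G x + v * G y)"
    using F inT A unfolding concave_on_iff by simp
  also have "\<dots> \<le> F (G (u * x + v * y))"
  proof (rule mono_onD[OF mono])
    show "u * G x + v * G y \<in> T" using cT inT A unfolding convex_def by auto
    show "G (u * x + v * y) \<in> T" using cS A inT unfolding convex_def by auto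
    show "u * G x + v * G y \<le> G (u * x + v * y)" using G A unfolding concave_on_iff by simp
  qed
  finally show "F (G (u *\<^sub>R x + v *\<^sub>R y)) \<ge> u * F (G x) + v * F (G y)" by simp
qed

lemma concave_on_suminf:
  fixes F :: "nat \<Rightarrow> real \<Rightarrow> real"
  assumes F: "\<And>k. concave_on S (F k)" and sums: "\<And>x. x \<in> S \<Longrightarrow> (\<lambda>k. F k x) sums G x"
  shows "concave_on S G"
  unfolding concave_on_iff
proof (intro conjI ballI allI impI)
  show cS: "convex S" using F[of 0] by (rule concave_on_imp_convex)
  fix x y u v :: real assume A: "x \<in> S" "y \<in> S" "0 \<le> u" "0 \<le> v" "u + v = 1"
  have z: "u *\<^sub>R x + v *\<^sub>R y \<in> S" using cS A unfolding convex_def by auto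
  show "u * G x + v * G y \<le> G (u *\<^sub>R x + v *\<^sub>R y)"
  proof (rule sums_le)
    show "(\<lambda>k. u * F k x + v * F k y) sums (u * G x + v * G y)"
      by (intro sums_add sums_mult sums A)
    show "(\<lambda>k. F k (u *\<^sub>R x + v *\<^sub>R y)) sums G (u *\<^sub>R x + v *\<^sub>R y)" by (rule sums[OF z])
    show "u * F k x + v * F k y \<le> F k (u *\<^sub>R x + v *\<^sub>R y)" for k
      using F[of k] A unfolding concave_on_iff by auto
  qed
qed

lemma concave_on_eqI:
  fixes F G :: "real \<Rightarrow> real"
  assumes F: "concave_on S F" and eq: "\<And>x. x \<in> S \<Longrightarrow> F x = G x"
  shows "concave_on S G"
  unfolding concave_on_iff
proof (intro conjI ballI allI impI)
  show cS: "convex S" using F by (rule concave_on_imp_convex)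
  fix x y u v :: real assume A: "x \<in> S" "y \<in> S" "0 \<le> u" "0 \<le> v" "u + v = 1"
  have "u *\<^sub>R x + v *\<^sub>R y \<in> S" using cS A unfolding convex_def by blast
  then show "u * G x + v * G y \<le> G (u *\<^sub>R x + v *\<^sub>R y)"
    using F A eq unfolding concave_on_iff by metis
qed

section \<open>Lebesgue measure on the unit interval\<close>

text \<open>Lebesgue measure on the Borel subsets of the unit interval. Borel sets are kept until the last step
  because preimages of Borel sets under the map are Borel.\<close>

definition unit_lebesgue :: "real measure" where
  "unit_lebesgue = restrict_space lborel {0..<1}"

lemma space_unit [simp]: "space unit_lebesgue = {0..<1}"
  by (simp add: unit_lebesgue_def)

lemma measurable_unitI: "h \<in> borel_measurable borel \<Longrightarrow> h \<in> borel_measurable unit_lebesgue"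
  unfolding unit_lebesgue_def by (rule measurable_restrict_space1) simp

lemma finite_measure_unit: "finite_measure unit_lebesgue"
  by (rule finite_measureI) (simp add: unit_lebesgue_def emeasure_restrict_space)

lemma measure_unit_less: "0 \<le> t \<Longrightarrow> t \<le> 1 \<Longrightarrow> measure unit_lebesgue {x \<in> space unit_lebesgue. x < t} = t"
proof -
  assume t: "0 \<le> t" "t \<le> 1"
  have "{x \<in> space unit_lebesgue. x < t} = {0..<t}" using t by auto
  moreover have "measure unit_lebesgue {0..<t} = measure lborel {0..<t}"
    unfolding unit_lebesgue_def using t by (subst measure_restrict_space) auto
  ultimately show ?thesis using t by simp
qed

lemma AE_lebesgue_on_unit:
  assumes "AE x in unit_lebesgue. P x"
  shows "AE x in lebesgue_on {0..<1}. P x"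
proof -
  have "AE x in lborel. x \<in> {0..<1} \<longrightarrow> P x"
    using assms unfolding unit_lebesgue_def by (subst (asm) AE_restrict_space_iff) auto
  then have "AE x in lebesgue. x \<in> {0..<1} \<longrightarrow> P x" by (rule AE_completion)
  then show ?thesis by (subst AE_restrict_space_iff) auto
qed

lemma eventually_not_in_AE:
  assumes A: "\<And>m. A m \<in> sets unit_lebesgue" and B: "summable B"
    and le: "\<forall>\<^sub>F m in sequentially. measure unit_lebesgue (A m) \<le> B m"
  shows "AE x in unit_lebesgue. \<forall>\<^sub>F m in sequentially. x \<notin> A m"
proof -
  have "summable (\<lambda>m. measure unit_lebesgue (A m))"
    by (rule summable_comparison_test_ev[OF _ B]) (rule eventually_mono[OF le], simp)
  then have "AE x in unit_lebesgue. \<forall>\<^sub>F m in sequentially. x \<in> space unit_lebesgue - A m"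
    using A by (intro borel_cantelli_AE1) (simp_all add: less_top[symmetric] finite_measure.emeasure_finite[OF finite_measure_unit])
  then show ?thesis by eventually_elim (rule eventually_mono, blast+)
qed

section \<open>The branches of the map and the preimages of 1\<close>

locale intermittent =
  fixes \<alpha> :: real
  assumes alpha: "\<alpha> \<ge> 1"
begin

abbreviation f :: "real \<Rightarrow> real" where "f \<equiv> intermittent_map \<alpha>"

text \<open>The formula of the left branch, used on all of \<open>{0..}\<close>: the points beyond \<open>1/2\<close> provide room to the
  right of a chord when the slopes of the inverse branches are compared.\<close>

definition left_branch :: "real \<Rightarrow> real" where
  "left_branch x = x * (1 + 2 powr \<alpha> * x powr \<alpha>)"

lemma left_branch_eq: "x \<ge> 0 \<Longrightarrow> left_branch x = x + 2 powr \<alpha> * x powr (1 + \<alpha>)"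
  by (cases "x = 0") (simp_all add: left_branch_def algebra_simps powr_add)

lemma left_branch_less: "0 \<le> x \<Longrightarrow> x < y \<Longrightarrow> left_branch x < left_branch y"
  using alpha by (auto simp: left_branch_eq intro!: add_strict_mono powr_less_mono2)

lemma left_branch_le_iff: "0 \<le> x \<Longrightarrow> 0 \<le> y \<Longrightarrow> left_branch x \<le> left_branch y \<longleftrightarrow> x \<le> y"
  using left_branch_less[of x y] left_branch_less[of y x] by fastforce

lemma left_branch_ge: "0 \<le> x \<Longrightarrow> x \<le> left_branch x"
  by (simp add: left_branch_eq)

lemma left_branch_half: "left_branch (1/2) = 1"
  by (simp add: left_branch_def flip: powr_mult)

lemma left_branch_1: "left_branch 1 = 1 + 2 powr \<alpha>"
  by (simp add: left_branch_def)

lemma f_left: "x < 1/2 \<Longrightarrow> f x = left_branch x"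
  by (simp add: intermittent_map_def left_branch_def)

lemma f_right: "1/2 \<le> x \<Longrightarrow> f x = 2 * x - 1"
  by (simp add: intermittent_map_def)

lemma convex_on_left_branch: "convex_on {0..} left_branch"
proof -
  have "convex_on {0..} (\<lambda>x. x powr (1 + \<alpha>))"
  proof (rule convex_on_linorderI)
    fix t x y :: real assume A: "0 < t" "t < 1" "x \<in> {0..}" "y \<in> {0..}" "x < y"
    show "((1 - t) *\<^sub>R x + t *\<^sub>R y) powr (1 + \<alpha>) \<le> (1 - t) * x powr (1 + \<alpha>) + t * y powr (1 + \<alpha>)"
    proof (cases "x = 0")
      case True
      have "t powr (1 + \<alpha>) \<le> t powr 1" using A alpha by (intro powr_mono') auto
      then show ?thesis using True A by (simp add: powr_mult mult_right_mono)
    next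
      case False
      then show ?thesis using A alpha convex_onD[OF powr_convex, of "1 + \<alpha>" t x y] by auto
    qed
  qed auto
  then have "convex_on {0..} (\<lambda>x. x + 2 powr \<alpha> * x powr (1 + \<alpha>))"
    by (intro convex_on_add convex_on_cmul) (auto simp: convex_on_ident)
  then show ?thesis
    unfolding convex_on_def by (auto simp: left_branch_eq)
qed

lemma left_branch_surj: "0 \<le> y \<Longrightarrow> \<exists>x\<ge>0. left_branch x = y"
proof -
  assume y: "0 \<le> y"
  have "continuous_on {0..y} left_branch"
    unfolding left_branch_def using alpha by (auto intro!: continuous_on_mult continuous_on_add continuous_on_powr' continuous_on_const continuous_on_id)
  then show ?thesis
    using IVT'[of left_branch 0 y y] y left_branch_ge[of y] by (auto simp: left_branch_def)
qed

definition g :: "real \<Rightarrow> real" where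
  "g = inv_into {0..} left_branch"

lemma left_branch_g: "0 \<le> y \<Longrightarrow> left_branch (g y) = y"
  and g_nonneg: "0 \<le> y \<Longrightarrow> 0 \<le> g y"
  unfolding g_def using left_branch_surj[of y] f_inv_into_f[of y left_branch "{0..}"]
    inv_into_into[of y left_branch "{0..}"] by fastforce+

lemma g_left_branch: "0 \<le> x \<Longrightarrow> g (left_branch x) = x"
  by (metis left_branch_g g_nonneg left_branch_ge left_branch_le_iff order_antisym order_trans order_refl)

lemma g_less_iff: "0 \<le> x \<Longrightarrow> 0 \<le> y \<Longrightarrow> g x < g y \<longleftrightarrow> x < y"
  by (metis left_branch_g g_nonneg left_branch_le_iff not_le)

lemma g_le_iff: "0 \<le> x \<Longrightarrow> 0 \<le> y \<Longrightarrow> g x \<le> g y \<longleftrightarrow> x \<le> y"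
  using g_less_iff[of y x] by linarith

lemma left_branch_less_iff: "0 \<le> x \<Longrightarrow> 0 \<le> y \<Longrightarrow> left_branch x < y \<longleftrightarrow> x < g y"
  by (metis g_left_branch g_less_iff left_branch_ge order_trans)

lemma g_le: "0 \<le> y \<Longrightarrow> g y \<le> y"
  by (metis left_branch_g g_nonneg left_branch_ge)

lemma g_0 [simp]: "g 0 = 0"
  using g_le[of 0] g_nonneg[of 0] by simp

lemma g_1: "g 1 = 1/2"
  using g_left_branch[of "1/2"] by (simp add: left_branch_half)

lemma g_pos: "0 < y \<Longrightarrow> 0 < g y"
  using g_less_iff[of 0 y] by simp

lemma g_less: "0 < y \<Longrightarrow> g y < y"
  using left_branch_g[of y] g_pos[of y] by (simp add: left_branch_eq)
    (smt (verit) mult_pos_pos powr_gt_zero)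

lemma concave_on_g: "concave_on {0..} g"
  unfolding concave_on_iff
proof (intro conjI ballI allI impI)
  fix x y u v :: real assume A: "x \<in> {0..}" "y \<in> {0..}" "0 \<le> u" "0 \<le> v" "u + v = 1"
  have nn: "0 \<le> u * g x + v * g y" "0 \<le> u * x + v * y" using A by (auto simp: g_nonneg)
  have "left_branch (u * g x + v * g y) \<le> u * left_branch (g x) + v * left_branch (g y)"
    using convex_on_left_branch A g_nonneg unfolding convex_on_def by auto
  also have "\<dots> = u * x + v * y" using A by (simp add: left_branch_g)
  finally have "g (left_branch (u * g x + v * g y)) \<le> g (u * x + v * y)"
    using nn by (subst g_le_iff) (auto intro: order_trans[OF _ left_branch_ge])
  then show "u * g x + v * g y \<le> g (u *\<^sub>R x + v *\<^sub>R y)"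
    using nn by (simp add: g_left_branch)
qed (rule convex_real_interval)

lemma g_iter_nonneg: "0 \<le> y \<Longrightarrow> 0 \<le> (g ^^ k) y"
  by (induction k) (auto simp: g_nonneg)

lemma g_iter_less_iff: "0 \<le> x \<Longrightarrow> 0 \<le> y \<Longrightarrow> (g ^^ k) x < (g ^^ k) y \<longleftrightarrow> x < y"
  by (induction k) (auto simp: g_less_iff g_iter_nonneg)

lemma g_iter_le_iff: "0 \<le> x \<Longrightarrow> 0 \<le> y \<Longrightarrow> (g ^^ k) x \<le> (g ^^ k) y \<longleftrightarrow> x \<le> y"
  using g_iter_less_iff[of y x k] by linarith

lemma concave_on_g_iter: "concave_on {0..} (g ^^ k)"
proof (induction k)
  case (Suc k)
  have "concave_on {0..} (\<lambda>x. g ((g ^^ k) x))"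
    by (rule concave_on_compose_mono[OF concave_on_g Suc])
      (auto simp: g_iter_nonneg g_le_iff intro!: mono_onI)
  then show ?case by (simp add: o_def)
qed (simp add: concave_on_ident id_def)

text \<open>The points of \<open>{grid (Suc k)..<grid k}\<close> need exactly \<open>k\<close> steps to reach the right half of the
  interval.\<close>

definition grid :: "nat \<Rightarrow> real" where
  "grid k = (g ^^ k) 1"

lemma grid_0 [simp]: "grid 0 = 1" and grid_Suc: "grid (Suc k) = g (grid k)"
  by (simp_all add: grid_def)

lemma grid_1: "grid (Suc 0) = 1/2" by (simp add: grid_Suc g_1)

lemma grid_pos: "0 < grid k"
  by (induction k) (auto simp: grid_Suc g_pos)

lemma grid_Suc_less: "grid (Suc k) < grid k"
  using g_less[OF grid_pos[of k]] by (simp add: grid_Suc)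

lemma grid_mono: "i \<le> j \<Longrightarrow> grid j \<le> grid i"
  using lift_Suc_antimono_le[of grid i j] grid_Suc_less by (simp add: less_imp_le)

lemma grid_le_1: "grid k \<le> 1" using grid_mono[of 0 k] by simp

lemma g_iter_grid: "(g ^^ k) (grid i) = grid (k + i)"
  by (simp add: grid_def funpow_add)

text \<open>The reason for the exponent \<open>1/\<alpha>\<close>: with \<open>z = (2 * grid (Suc k)) powr \<alpha>\<close>, which is at most 1, the
  equation \<open>grid k = grid (Suc k) * (1 + z)\<close> shows that \<open>grid k powr (-\<alpha>)\<close> increases in one step by
  \<open>2 powr \<alpha> * (1 - (1 + z) powr (-\<alpha>)) / z\<close>, which lies between two positive constants.\<close>

lemma grid_asymp:
  "1 + 2 powr (\<alpha> - 1) * real k \<le> grid k powr (- \<alpha>) \<and> grid k powr (- \<alpha>) \<le> 1 + \<alpha> * 2 powr \<alpha> * real k"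
proof (induction k)
  case (Suc k)
  define y where "y = grid (Suc k)"
  define z where "z = 2 powr \<alpha> * y powr \<alpha>"
  have y: "0 < y" "y \<le> 1/2"
    using grid_pos[of "Suc k"] grid_mono[of 1 "Suc k"] by (simp_all add: y_def grid_1)
  have "z = (2 * y) powr \<alpha>" using y by (simp add: z_def powr_mult)
  then have z: "0 < z" "z \<le> 1" using y alpha by (auto simp: powr_le1)
  have "grid k = y * (1 + z)"
    using left_branch_g[of "grid k"] grid_pos[of k] by (simp add: y_def z_def grid_Suc left_branch_def)
  then have "grid k powr (-\<alpha>) = y powr (-\<alpha>) * (1 + z) powr (-\<alpha>)"
    using y z by (simp add: powr_mult)
  then have diff: "y powr (-\<alpha>) - grid k powr (-\<alpha>) = 2 powr \<alpha> / z * (1 - (1 + z) powr (-\<alpha>))"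
    using y by (simp add: z_def powr_minus field_simps)
  have "1 - (1 + z) powr (-\<alpha>) \<le> \<alpha> * z"
  proof -
    have "1 + (- \<alpha>) * z \<le> 1 + (- \<alpha>) * ln (1 + z)"
      using z alpha ln_add_one_self_le_self[of z] by (simp add: mult_left_mono)
    also have "\<dots> \<le> exp ((- \<alpha>) * ln (1 + z))" by (rule exp_ge_add_one_self)
    also have "\<dots> = (1 + z) powr (-\<alpha>)" using z by (simp add: powr_def)
    finally show ?thesis by simp
  qed
  then have up: "2 powr \<alpha> / z * (1 - (1 + z) powr (-\<alpha>)) \<le> \<alpha> * 2 powr \<alpha>"
    using z mult_left_mono[of "1 - (1 + z) powr (-\<alpha>)" "\<alpha> * z" "2 powr \<alpha> / z"] by (simp add: mult.commute)
  have "(1 + z) powr (-\<alpha>) \<le> (1 + z) powr (-1)" using alpha z by (intro powr_mono) auto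
  also have "\<dots> \<le> 1 - z / 2" using z by (simp add: powr_minus field_simps mult_le_one)
  finally have "2 powr \<alpha> / z * (1 - (1 + z) powr (-\<alpha>)) \<ge> 2 powr \<alpha> / z * (z / 2)"
    using z by (intro mult_left_mono) auto
  moreover have "2 powr \<alpha> / z * (z / 2) = 2 powr (\<alpha> - 1)" using z by (simp add: powr_diff)
  ultimately have "y powr (-\<alpha>) - grid k powr (-\<alpha>) \<ge> 2 powr (\<alpha> - 1)"
    by (simp only: diff)
  moreover have "y powr (-\<alpha>) - grid k powr (-\<alpha>) \<le> \<alpha> * 2 powr \<alpha>"
    using diff up by simp
  ultimately show ?case using Suc unfolding y_def by (auto simp: algebra_simps)
qed simp

lemma grid_upper: "0 < k \<Longrightarrow> grid k \<le> real k powr (- (1 / \<alpha>))"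
proof -
  assume k: "0 < k"
  have "real k \<le> 2 powr (\<alpha> - 1) * real k" using alpha ge_one_powr_ge_zero[of 2 "\<alpha> - 1"] mult_right_mono[of 1 "2 powr (\<alpha> - 1)" "real k"] by simp
  also have "\<dots> \<le> grid k powr (-\<alpha>)" using grid_asymp[of k] by linarith
  finally have "(grid k powr (-\<alpha>)) powr (- (1 / \<alpha>)) \<le> real k powr (- (1 / \<alpha>))"
    using k alpha by (intro powr_mono2') auto
  then show ?thesis using grid_pos[of k] alpha by (simp add: powr_powr)
qed

definition grid_const :: real where "grid_const = (1 + \<alpha> * 2 powr \<alpha>) powr (- (1 / \<alpha>))"

lemma grid_const_pos: "0 < grid_const"
  using alpha by (simp add: grid_const_def) (smt (verit) mult_nonneg_nonneg powr_ge_zero)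

lemma grid_lower: "0 < k \<Longrightarrow> grid_const * real k powr (- (1 / \<alpha>)) \<le> grid k"
proof -
  assume k: "0 < k"
  have c: "0 \<le> \<alpha> * 2 powr \<alpha>" using alpha by simp
  have "grid k powr (-\<alpha>) \<le> (1 + \<alpha> * 2 powr \<alpha>) * real k" using grid_asymp[of k] k
    by (simp add: algebra_simps)
  then have "((1 + \<alpha> * 2 powr \<alpha>) * real k) powr (- (1 / \<alpha>)) \<le> (grid k powr (-\<alpha>)) powr (- (1 / \<alpha>))"
    using grid_pos[of k] alpha by (intro powr_mono2') auto
  then show ?thesis using grid_pos[of k] alpha k c by (simp add: powr_powr powr_mult grid_const_def)
qed

lemma grid_tendsto_0: "grid \<longlonglongrightarrow> 0"
proof (rule tendsto_sandwich[of "\<lambda>_. 0" _ _ "\<lambda>k. real k powr (- (1 / \<alpha>))"])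
  show "(\<lambda>k. real k powr (- (1 / \<alpha>))) \<longlonglongrightarrow> 0"
    using alpha by (intro tendsto_neg_powr filterlim_real_sequentially) auto
  show "\<forall>\<^sub>F k in sequentially. grid k \<le> real k powr (- (1 / \<alpha>))"
    using eventually_gt_at_top[of 0] by eventually_elim (rule grid_upper)
qed (auto simp: less_imp_le grid_pos)

interpretation U: finite_measure unit_lebesgue by (rule finite_measure_unit)

section \<open>Distribution functions and the lower bound on the distance\<close>

lemma f_measurable: "f \<in> borel_measurable borel"
  unfolding intermittent_map_def[abs_def] by measurable

lemma f_iter_measurable [measurable]: "(f ^^ j) \<in> borel_measurable borel"
  by (induction j) (auto simp: o_def intro!: measurable_compose[OF _ f_measurable])

lemma f_iter_measurable_unit [measurable]: "(f ^^ j) \<in> borel_measurable unit_lebesgue"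
  by (rule measurable_unitI) simp

lemma g_le_half: "0 \<le> t \<Longrightarrow> t \<le> 1 \<Longrightarrow> g t \<le> 1/2"
  using g_le_iff[of t 1] by (simp add: g_1)

lemma f_range: "x \<in> {0..<1} \<Longrightarrow> f x \<in> {0..<1}"
  using left_branch_less[of x "1/2"] left_branch_ge[of x]
  by (cases "x < 1/2") (auto simp: f_left f_right left_branch_half)

lemma f_iter_range: "x \<in> {0..<1} \<Longrightarrow> (f ^^ j) x \<in> {0..<1}"
  using f_range by (induction j) auto

lemma f_less_iff:
  assumes "x \<in> {0..<1}" "0 \<le> t" "t \<le> 1"
  shows "f x < t \<longleftrightarrow> x < g t \<or> (1/2 \<le> x \<and> x < (1 + t) / 2)"
  using assms g_le_half[of t] left_branch_less_iff[of x t]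
  by (cases "x < 1/2") (auto simp: f_left f_right)

text \<open>A point below \<open>grid k\<close> stays on the left branch for \<open>k\<close> steps, so these steps are undone by \<open>g\<close>.\<close>

lemma excursion:
  assumes "0 \<le> y" "y < grid k" "i \<le> k"
  shows "0 \<le> (f ^^ i) y \<and> (f ^^ i) y < grid (k - i) \<and> (g ^^ i) ((f ^^ i) y) = y"
  using assms(3)
proof (induction i)
  case (Suc i)
  define z where "z = (f ^^ i) y"
  have z: "0 \<le> z" "z < grid (k - i)" "(g ^^ i) z = y" using Suc by (auto simp: z_def)
  have e: "k - i = Suc (k - Suc i)" using Suc by simp
  have "z < 1/2" using z grid_mono[of 1 "k - i"] e by (simp add: grid_1)
  then have fz: "f z = left_branch z" by (rule f_left)
  have "left_branch z < grid (k - Suc i)"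
    using z grid_pos[of "k - Suc i"] by (subst left_branch_less_iff) (auto simp: e grid_Suc)
  then show ?case
    using z fz left_branch_ge[of z] g_left_branch[of z]
    by (simp add: z_def[symmetric] del: funpow.simps) (simp add: z_def[symmetric] fz funpow_swap1)
qed (use assms in auto)

definition cdf :: "nat \<Rightarrow> real \<Rightarrow> real" where
  "cdf j t = measure unit_lebesgue {x \<in> space unit_lebesgue. (f ^^ j) x < t}"

lemma sets_f_iter_less: "{x \<in> space unit_lebesgue. (f ^^ j) x < t} \<in> sets unit_lebesgue"
  and sets_f_iter_between:
    "{x \<in> space unit_lebesgue. s \<le> (f ^^ j) x \<and> (f ^^ j) x < t} \<in> sets unit_lebesgue"
  by measurable

lemma cdf_diff:
  assumes "s \<le> t"
  shows "measure unit_lebesgue {x \<in> space unit_lebesgue. s \<le> (f ^^ j) x \<and> (f ^^ j) x < t} = cdf j t - cdf j s"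
proof -
  let ?A = "\<lambda>t. {x \<in> space unit_lebesgue. (f ^^ j) x < t}"
  have eq: "{x \<in> space unit_lebesgue. s \<le> (f ^^ j) x \<and> (f ^^ j) x < t} = ?A t - ?A s"
    by auto
  have "?A s \<subseteq> ?A t" using assms by auto
  then show ?thesis unfolding cdf_def eq
    by (rule U.finite_measure_Diff[OF sets_f_iter_less sets_f_iter_less])
qed

lemma cdf_mono: "s \<le> t \<Longrightarrow> cdf j s \<le> cdf j t"
  unfolding cdf_def by (intro U.finite_measure_mono sets_f_iter_less) auto

lemma cdf_1: "cdf j 1 = 1"
proof -
  have "{x \<in> space unit_lebesgue. (f ^^ j) x < 1} = {x \<in> space unit_lebesgue. x < 1}"
    using f_iter_range by auto
  then show ?thesis unfolding cdf_def using measure_unit_less[of 1] by (simp only:)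
qed

lemma cdf_Suc:
  assumes t: "0 \<le> t" "t \<le> 1"
  shows "cdf (Suc j) t = cdf j (g t) + (cdf j ((1 + t) / 2) - cdf j (1/2))"
proof -
  let ?A = "{x \<in> space unit_lebesgue. (f ^^ j) x < g t}"
  let ?B = "{x \<in> space unit_lebesgue. 1/2 \<le> (f ^^ j) x \<and> (f ^^ j) x < (1 + t) / 2}"
  have "{x \<in> space unit_lebesgue. (f ^^ Suc j) x < t} = ?A \<union> ?B"
    using f_less_iff[OF f_iter_range t] by (auto simp: space_unit)
  moreover have "measure unit_lebesgue (?A \<union> ?B) = measure unit_lebesgue ?A + measure unit_lebesgue ?B"
    using g_le_half[OF t]
    by (intro U.finite_measure_Union sets_f_iter_less sets_f_iter_between) auto
  moreover have "measure unit_lebesgue ?B = cdf j ((1 + t) / 2) - cdf j (1/2)"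
    using t by (intro cdf_diff) auto
  ultimately show ?thesis by (simp add: cdf_def)
qed

text \<open>Each summand in \<open>cdf_Suc\<close> is the previous distribution function composed with a concave inverse
  branch.\<close>

lemma concave_on_cdf: "concave_on {0..1} (cdf j)"
proof (induction j)
  case 0
  have "concave_on {0..1::real} (\<lambda>t. t)" by (simp add: concave_on_ident)
  then show ?case
    by (rule concave_on_eqI) (use measure_unit_less in \<open>auto simp: cdf_def simp del: space_unit\<close>)
next
  case (Suc j)
  have mono: "mono_on {0..1} (cdf j)" by (intro mono_onI cdf_mono)
  have "concave_on {0..1} g"
    using concave_on_g unfolding concave_on_def by (rule convex_on_subset) auto
  then have 1: "concave_on {0..1} (\<lambda>t. cdf j (g t))"
    using g_le_half g_nonneg by (intro concave_on_compose_mono[OF Suc _ _ mono]) fastforce+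
  have "concave_on {0..1::real} (\<lambda>t. (1 + t) / 2)"
    by (intro concave_on_cdiv concave_on_add) (auto simp: concave_on_ident concave_on_const)
  then have 2: "concave_on {0..1} (\<lambda>t. cdf j ((1 + t) / 2))"
    by (intro concave_on_compose_mono[OF Suc _ _ mono]) auto
  have "concave_on {0..1} (\<lambda>t. cdf j (g t) + (cdf j ((1 + t) / 2) - cdf j (1/2)))"
    by (intro concave_on_add 1 concave_on_diff 2) (auto simp: convex_on_const)
  then show ?case
    by (rule concave_on_eqI) (use cdf_Suc in auto)
qed

text \<open>Once a point lies in \<open>{1/2..<1/2 + grid n / 2}\<close>, its next image is below \<open>grid n\<close> and it stays out of
  the right half until time \<open>n\<close>; hence the events for different \<open>j < n\<close> are disjoint. The density is
  decreasing, so this leftmost part of the right half, of relative length \<open>grid n\<close>, carries at least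
  this proportion of the mass of the right half.\<close>

lemma visits_right_half:
  "grid n * (\<Sum>j<n. 1 - cdf j (1/2)) \<le> 1"
proof -
  define E where "E j = {x \<in> space unit_lebesgue. 1/2 \<le> (f ^^ j) x \<and> (f ^^ j) x < 1/2 + grid n / 2}" for j
  have E: "E j \<in> sets unit_lebesgue" for j unfolding E_def by (rule sets_f_iter_between)
  have later: "(f ^^ i) x < 1/2" if "x \<in> E j" "j < i" "i < n" for i j x
  proof -
    define y where "y = (f ^^ Suc j) x"
    have x: "x \<in> {0..<1}" using that by (simp add: E_def)
    have y: "y < grid n" using that by (simp add: E_def y_def f_right)
    have "(f ^^ (i - Suc j)) y < grid (n - (i - Suc j))"
      using excursion[of y n "i - Suc j"] y f_iter_range[OF x, of "Suc j"] that by (auto simp: y_def)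
    also have "\<dots> \<le> grid 1" using that by (intro grid_mono) auto
    also have "(f ^^ (i - Suc j)) y = (f ^^ ((i - Suc j) + Suc j)) x"
      unfolding y_def funpow_add by simp
    finally show ?thesis using that by (simp add: grid_1)
  qed
  have disj: "disjoint_family_on E {..<n}"
  proof -
    have "False" if "x \<in> E i" "x \<in> E j" "i < j" "j < n" for x i j
      using later[of x i j] that by (simp add: E_def)
    then show ?thesis unfolding disjoint_family_on_def
      by (metis disjoint_iff lessThan_iff linorder_neq_iff)
  qed
  have "grid n * (\<Sum>j<n. 1 - cdf j (1/2)) = (\<Sum>j<n. grid n * (1 - cdf j (1/2)))"
    by (simp add: sum_distrib_left)
  also have "\<dots> \<le> (\<Sum>j<n. measure unit_lebesgue (E j))"
  proof (rule sum_mono)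
    fix j
    have "measure unit_lebesgue (E j) = cdf j (1/2 + grid n / 2) - cdf j (1/2)"
      unfolding E_def using grid_pos[of n] by (intro cdf_diff) auto
    moreover have "(cdf j 1 - cdf j (1/2 + grid n / 2)) * (1/2 + grid n / 2 - 1/2)
        \<le> (cdf j (1/2 + grid n / 2) - cdf j (1/2)) * (1 - (1/2 + grid n / 2))"
      using grid_pos[of n] grid_le_1[of n] by (intro concave_on_slopes[OF concave_on_cdf]) auto
    ultimately show "grid n * (1 - cdf j (1/2)) \<le> measure unit_lebesgue (E j)"
      by (simp add: cdf_1 algebra_simps)
  qed
  also have "\<dots> = measure unit_lebesgue (\<Union>j<n. E j)"
    using E disj by (intro U.finite_measure_finite_Union[symmetric]) auto
  also have "\<dots> \<le> measure unit_lebesgue (space unit_lebesgue)" by (rule U.bounded_measure)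
  also have "space unit_lebesgue = {x \<in> space unit_lebesgue. x < 1}" by auto
  also have "measure unit_lebesgue \<dots> = 1" by (rule measure_unit_less) auto
  finally show ?thesis .
qed

text \<open>Choose \<open>k\<close> with \<open>grid k < \<delta>\<close>. The density on \<open>{a..<b}\<close> is at most the average density on
  \<open>{grid (Suc k)..<grid k}\<close>, which lies further left, and the points there are in the right half after
  \<open>k\<close> steps. So the number of visits to \<open>{a..<b}\<close> is controlled by \<open>visits_right_half\<close>.\<close>

lemma occupation_bound:
  assumes \<delta>: "0 < \<delta>"
  shows "\<exists>C>0. \<forall>n a b. 0 < n \<longrightarrow> \<delta> \<le> a \<longrightarrow> a \<le> b \<longrightarrow> b \<le> 1 \<longrightarrow>
       (\<Sum>j<n. cdf j b - cdf j a) \<le> C * (b - a) * real n powr (1 / \<alpha>)"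
proof -
  have "\<forall>\<^sub>F k in sequentially. grid k < \<delta>" using grid_tendsto_0 \<delta> by (rule order_tendstoD)
  then obtain k where k: "grid k < \<delta>" by (auto simp: eventually_sequentially)
  define w where "w = grid k - grid (Suc k)"
  have w: "0 < w" unfolding w_def using grid_Suc_less[of k] by simp
  define C where "C = (1 + real k) powr (1 / \<alpha>) / (grid_const * w)"
  show ?thesis
  proof (intro exI[of _ C] conjI allI impI)
    show "0 < C" using w grid_const_pos unfolding C_def by simp
    fix n :: nat and a b :: real
    assume n: "0 < n" and ab: "\<delta> \<le> a" "a \<le> b" "b \<le> 1"
    have step: "cdf j b - cdf j a \<le> (b - a) / w * (1 - cdf (j + k) (1/2))" for j
    proof -
      have "(cdf j b - cdf j a) * w \<le> (cdf j (grid k) - cdf j (grid (Suc k))) * (b - a)"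
        unfolding w_def using grid_Suc_less[of k] k ab grid_pos[of "Suc k"]
        by (intro concave_on_slopes[OF concave_on_cdf]) auto
      moreover have "cdf j (grid k) - cdf j (grid (Suc k)) \<le> 1 - cdf (j + k) (1/2)"
      proof -
        have "cdf j (grid k) - cdf j (grid (Suc k)) = measure unit_lebesgue
           {x \<in> space unit_lebesgue. grid (Suc k) \<le> (f ^^ j) x \<and> (f ^^ j) x < grid k}"
          using grid_Suc_less[of k] by (intro cdf_diff[symmetric]) auto
        also have "\<dots> \<le> measure unit_lebesgue
           {x \<in> space unit_lebesgue. 1/2 \<le> (f ^^ (j + k)) x \<and> (f ^^ (j + k)) x < 1}"
        proof (rule U.finite_measure_mono)
          show "{x \<in> space unit_lebesgue. grid (Suc k) \<le> (f ^^ j) x \<and> (f ^^ j) x < grid k}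
             \<subseteq> {x \<in> space unit_lebesgue. 1/2 \<le> (f ^^ (j + k)) x \<and> (f ^^ (j + k)) x < 1}"
          proof safe
            fix x assume x: "x \<in> space unit_lebesgue" "grid (Suc k) \<le> (f ^^ j) x" "(f ^^ j) x < grid k"
            define y where "y = (f ^^ j) x"
            have y: "0 \<le> y" "y < grid k" using x f_iter_range[of x j] by (auto simp: y_def)
            have e: "(f ^^ (j + k)) x = (f ^^ k) y"
              by (simp add: y_def add.commute[of j k] funpow_add)
            have "(g ^^ k) (1/2) \<le> (g ^^ k) ((f ^^ k) y)"
              using x excursion[OF y, of k] g_iter_grid[of k 1] by (simp add: y_def grid_1)
            then show "1/2 \<le> (f ^^ (j + k)) x"
              using excursion[OF y, of k] by (subst (asm) g_iter_le_iff) (auto simp: e)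
            show "(f ^^ (j + k)) x < 1" using x f_iter_range[of x "j + k"] by auto
          qed
        qed (rule sets_f_iter_between)
        also have "\<dots> = cdf (j + k) 1 - cdf (j + k) (1/2)" by (rule cdf_diff) simp
        finally show ?thesis by (simp add: cdf_1)
      qed
      ultimately have "(cdf j b - cdf j a) * w \<le> (1 - cdf (j + k) (1/2)) * (b - a)"
        using ab by (meson diff_ge_0_iff_ge mult_right_mono order_trans)
      then show ?thesis using w by (simp add: field_simps)
    qed
    have "(\<Sum>j<n. 1 - cdf (j + k) (1/2)) = (\<Sum>j\<in>{k..<n + k}. 1 - cdf j (1/2))"
      by (rule sum.reindex_bij_witness[of _ "\<lambda>j. j - k" "\<lambda>j. j + k"]) auto
    also have "\<dots> \<le> (\<Sum>j<n + k. 1 - cdf j (1/2))"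
      using cdf_mono[of "1/2" 1] by (intro sum_mono2) (auto simp: cdf_1)
    also have "\<dots> \<le> 1 / grid (n + k)"
      using visits_right_half[of "n + k"] grid_pos[of "n + k"] by (simp add: field_simps)
    also have "\<dots> \<le> 1 / (grid_const * real (n + k) powr (- (1 / \<alpha>)))"
      using grid_lower[of "n + k"] n grid_const_pos by (intro divide_left_mono) (auto simp: grid_pos)
    also have "\<dots> = real (n + k) powr (1 / \<alpha>) / grid_const" by (simp add: powr_minus field_simps)
    also have "\<dots> \<le> ((1 + real k) * real n) powr (1 / \<alpha>) / grid_const"
    proof -
      have "real k * 1 \<le> real k * real n" using n by (intro mult_left_mono) auto
      then show ?thesis
        using alpha grid_const_pos by (intro divide_right_mono powr_mono2) (auto simp: algebra_simps)
    qed
    also have "\<dots> = C * w * real n powr (1 / \<alpha>)"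
      using w grid_const_pos by (simp add: C_def powr_mult)
    finally have visits: "(\<Sum>j<n. 1 - cdf (j + k) (1/2)) \<le> C * w * real n powr (1 / \<alpha>)" .
    have "(\<Sum>j<n. cdf j b - cdf j a) \<le> (\<Sum>j<n. (b - a) / w * (1 - cdf (j + k) (1/2)))"
      by (intro sum_mono step)
    also have "\<dots> = (b - a) / w * (\<Sum>j<n. 1 - cdf (j + k) (1/2))" by (simp add: sum_distrib_left)
    also have "\<dots> \<le> (b - a) / w * (C * w * real n powr (1 / \<alpha>))"
      using ab w by (intro mult_left_mono visits) auto
    also have "\<dots> = C * (b - a) * real n powr (1 / \<alpha>)" using w by simp
    finally show "(\<Sum>j<n. cdf j b - cdf j a) \<le> C * (b - a) * real n powr (1 / \<alpha>)" .
  qed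
qed

text \<open>For \<open>p > 0\<close> this is the union bound over the visits. For \<open>p = 0\<close> that bound would be too weak, since
  orbits stay near 0 for a long time; but the left branch moves points to the right, so \<open>{0..<r}\<close> can
  only be entered through \<open>{1/2..<1/2 + r/2}\<close>.\<close>

lemma hitting_bound:
  assumes p: "0 \<le> p" "p \<le> 1"
  shows "\<exists>C>0. \<exists>r0>0. \<forall>r n. 0 < r \<longrightarrow> r \<le> r0 \<longrightarrow> 0 < n \<longrightarrow>
       measure unit_lebesgue {x \<in> space unit_lebesgue. \<exists>j<n. dist ((f ^^ j) x) p < r}
       \<le> C * r * real n powr (1 / \<alpha>)"
proof (cases "p = 0")
  case True
  obtain C where C: "0 < C" "\<forall>n a b. 0 < n \<longrightarrow> 1/2 \<le> a \<longrightarrow> a \<le> b \<longrightarrow> b \<le> 1 \<longrightarrow>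
       (\<Sum>j<n. cdf j b - cdf j a) \<le> C * (b - a) * real n powr (1 / \<alpha>)"
    using occupation_bound[OF half_gt_zero[OF zero_less_one]] by (elim exE conjE) (rule that)
  show ?thesis
  proof (rule exI[of _ "1 + C"], intro exI[of _ 1] conjI allI impI)
    show "0 < 1 + C" using C by simp
    fix r :: real and n :: nat assume r: "0 < r" "r \<le> 1" and n: "0 < n"
    \<comment> \<open>the preimage of \<open>{0..<r}\<close> on the right branch\<close>
    let ?I = "\<lambda>j. {x \<in> space unit_lebesgue. 1/2 \<le> (f ^^ j) x \<and> (f ^^ j) x < 1/2 + r / 2}"
    let ?Z = "{x \<in> space unit_lebesgue. (f ^^ 0) x < r}"
    have enter: "(f ^^ j) x < r \<Longrightarrow> x < r \<or> (\<exists>i<j. x \<in> ?I i)" if x: "x \<in> {0..<1}" for j x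
    proof (induction j)
      case (Suc j)
      let ?y = "(f ^^ j) x"
      have y: "?y \<in> {0..<1}" using x by (rule f_iter_range)
      have "?y < r" if "?y < 1/2"
        using left_branch_ge[of ?y] y Suc.prems that by (simp add: f_left)
      then show ?case
        using Suc x by (cases "?y < 1/2") (fastforce simp: f_right less_Suc_eq)+
    qed simp
    have "measure unit_lebesgue {x \<in> space unit_lebesgue. \<exists>j<n. dist ((f ^^ j) x) p < r}
        \<le> measure unit_lebesgue (?Z \<union> (\<Union>j<n. ?I j))"
    proof (rule U.finite_measure_mono)
      show "?Z \<union> (\<Union>j<n. ?I j) \<in> sets unit_lebesgue"
        by (intro sets.Un sets.finite_UN sets_f_iter_less sets_f_iter_between) auto
      show "{x \<in> space unit_lebesgue. \<exists>j<n. dist ((f ^^ j) x) p < r} \<subseteq> ?Z \<union> (\<Union>j<n. ?I j)"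
      proof
        fix x assume "x \<in> {x \<in> space unit_lebesgue. \<exists>j<n. dist ((f ^^ j) x) p < r}"
        then obtain j where x: "x \<in> {0..<1}" and j: "j < n" "\<bar>(f ^^ j) x\<bar> < r"
          by (auto simp: dist_real_def True)
        then have "x < r \<or> (\<exists>i<j. x \<in> ?I i)" by (intro enter) auto
        then show "x \<in> ?Z \<union> (\<Union>j<n. ?I j)" using x j by (auto intro: less_trans)
      qed
    qed
    also have "\<dots> \<le> measure unit_lebesgue ?Z + measure unit_lebesgue (\<Union>j<n. ?I j)"
      by (intro measure_Un_le sets.finite_UN sets_f_iter_less sets_f_iter_between) auto
    also have "measure unit_lebesgue ?Z = r" using r measure_unit_less[of r] by simp
    also have "measure unit_lebesgue (\<Union>j<n. ?I j) \<le> (\<Sum>j<n. measure unit_lebesgue (?I j))"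
      by (intro U.finite_measure_subadditive_finite) (auto simp del: space_unit intro: sets_f_iter_between)
    also have "\<dots> = (\<Sum>j<n. cdf j (1/2 + r / 2) - cdf j (1/2))"
      using r by (intro sum.cong refl cdf_diff) auto
    also have "\<dots> \<le> C * (1/2 + r / 2 - 1/2) * real n powr (1 / \<alpha>)"
      using r n by (intro C(2)[rule_format]) auto
    finally have "measure unit_lebesgue {x \<in> space unit_lebesgue. \<exists>j<n. dist ((f ^^ j) x) p < r}
        \<le> r + C * (r / 2) * real n powr (1 / \<alpha>)" by simp
    also have "\<dots> \<le> r * real n powr (1 / \<alpha>) + C * r * real n powr (1 / \<alpha>)"
      using r n C(1) alpha ge_one_powr_ge_zero[of "real n" "1 / \<alpha>"]
      by (intro add_mono mult_right_mono mult_left_mono) auto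
    finally show "measure unit_lebesgue {x \<in> space unit_lebesgue. \<exists>j<n. dist ((f ^^ j) x) p < r}
        \<le> (1 + C) * r * real n powr (1 / \<alpha>)" by (simp add: algebra_simps)
  qed simp
next
  case False
  then have p0: "0 < p / 2" using p by simp
  obtain C where C: "0 < C" "\<forall>n a b. 0 < n \<longrightarrow> p / 2 \<le> a \<longrightarrow> a \<le> b \<longrightarrow> b \<le> 1 \<longrightarrow>
       (\<Sum>j<n. cdf j b - cdf j a) \<le> C * (b - a) * real n powr (1 / \<alpha>)"
    using occupation_bound[OF p0] by (elim exE conjE) (rule that)
  show ?thesis
  proof (rule exI[of _ "2 * C"], intro exI[of _ "p / 2"] conjI allI impI)
    show "0 < 2 * C" "0 < p / 2" using C p0 by auto
    fix r :: real and n :: nat assume r: "0 < r" "r \<le> p / 2" and n: "0 < n"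
    define b where "b = min 1 (p + r)"
    have b: "p / 2 \<le> p - r" "p - r \<le> b" "b \<le> 1" "b \<le> p + r" using r p by (auto simp: b_def)
    let ?I = "\<lambda>j. {x \<in> space unit_lebesgue. p - r \<le> (f ^^ j) x \<and> (f ^^ j) x < b}"
    have "measure unit_lebesgue {x \<in> space unit_lebesgue. \<exists>j<n. dist ((f ^^ j) x) p < r}
        \<le> measure unit_lebesgue (\<Union>j<n. ?I j)"
    proof (rule U.finite_measure_mono)
      show "(\<Union>j<n. ?I j) \<in> sets unit_lebesgue"
        by (intro sets.finite_UN sets_f_iter_between) auto
      show "{x \<in> space unit_lebesgue. \<exists>j<n. dist ((f ^^ j) x) p < r} \<subseteq> (\<Union>j<n. ?I j)"
      proof
        fix x assume "x \<in> {x \<in> space unit_lebesgue. \<exists>j<n. dist ((f ^^ j) x) p < r}"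
        then obtain j where x: "x \<in> {0..<1}" and j: "j < n" "\<bar>(f ^^ j) x - p\<bar> < r"
          by (auto simp: dist_real_def)
        moreover have "(f ^^ j) x < 1" using f_iter_range[OF x, of j] by simp
        ultimately have "x \<in> ?I j" unfolding b_def by (auto simp: abs_less_iff)
        then show "x \<in> (\<Union>j<n. ?I j)" using j(1) by blast
      qed
    qed
    also have "measure unit_lebesgue (\<Union>j<n. ?I j) \<le> (\<Sum>j<n. measure unit_lebesgue (?I j))"
      by (intro U.finite_measure_subadditive_finite) (auto simp del: space_unit intro: sets_f_iter_between)
    also have "\<dots> = (\<Sum>j<n. cdf j b - cdf j (p - r))"
      using b by (intro sum.cong refl cdf_diff) auto
    also have "\<dots> \<le> C * (b - (p - r)) * real n powr (1 / \<alpha>)"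
      using b n by (intro C(2)[rule_format]) auto
    also have "\<dots> \<le> C * (2 * r) * real n powr (1 / \<alpha>)"
      using b C(1) by (intro mult_right_mono mult_left_mono) auto
    finally show "measure unit_lebesgue {x \<in> space unit_lebesgue. \<exists>j<n. dist ((f ^^ j) x) p < r}
        \<le> 2 * C * r * real n powr (1 / \<alpha>)" by (simp add: algebra_simps)
  qed
qed

lemma sets_dist_iter:
  "{x \<in> space unit_lebesgue. \<exists>j<n. dist ((f ^^ j) x) p < r} \<in> sets unit_lebesgue"
proof -
  have "(\<Union>j<n. {x \<in> space unit_lebesgue. dist ((f ^^ j) x) p < r}) \<in> sets unit_lebesgue"
    by (intro sets.finite_UN) measurable
  then show ?thesis by (rule back_subst) blast
qed

text \<open>At this radius \<open>hitting_bound\<close> gives a probability of order \<open>1 / m ^ 2\<close>, which is summable.\<close>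

lemma AE_distance_lower:
  assumes p: "0 \<le> p" "p \<le> 1"
  shows "AE x in unit_lebesgue. \<forall>\<^sub>F m in sequentially. \<forall>j<2^m.
      1 / (real m ^ 2 * 2 powr (real m / \<alpha>)) \<le> dist ((f ^^ j) x) p"
proof -
  define r where "r m = 1 / (real m ^ 2 * 2 powr (real m / \<alpha>))" for m
  obtain C r0 where C: "0 < C" "0 < r0"
    "\<forall>r n. 0 < r \<longrightarrow> r \<le> r0 \<longrightarrow> 0 < n \<longrightarrow>
       measure unit_lebesgue {x \<in> space unit_lebesgue. \<exists>j<n. dist ((f ^^ j) x) p < r}
       \<le> C * r * real n powr (1 / \<alpha>)"
    using hitting_bound[OF p] by (elim exE conjE) (rule that)
  have "AE x in unit_lebesgue. \<forall>\<^sub>F m in sequentially.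
      x \<notin> {x \<in> space unit_lebesgue. \<exists>j<2^m. dist ((f ^^ j) x) p < r m}"
  proof (rule eventually_not_in_AE[OF sets_dist_iter])
    show "summable (\<lambda>m. C * (1 / real m ^ 2))"
      by (intro summable_mult) (use inverse_power_summable[of 2] in \<open>simp add: field_simps\<close>)
    have "r \<longlonglongrightarrow> 0"
    proof (rule tendsto_sandwich[of "\<lambda>_. 0" _ _ "\<lambda>m. 1 / real m"])
      show "\<forall>\<^sub>F m in sequentially. r m \<le> 1 / real m"
        using eventually_gt_at_top[of 0]
      proof eventually_elim
        case (elim m)
        have "real m * 1 \<le> (real m * real m) * 2 powr (real m / \<alpha>)"
          using elim alpha by (intro mult_mono ge_one_powr_ge_zero) auto
        then show ?case using elim unfolding r_def
          by (intro divide_left_mono) (auto simp: power2_eq_square)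
      qed
    qed (auto simp: r_def lim_1_over_n)
    then have "\<forall>\<^sub>F m in sequentially. r m < r0" using C(2) by (rule order_tendstoD)
    then show "\<forall>\<^sub>F m in sequentially. measure unit_lebesgue
        {x \<in> space unit_lebesgue. \<exists>j<2^m. dist ((f ^^ j) x) p < r m} \<le> C * (1 / real m ^ 2)"
      using eventually_gt_at_top[of 0]
    proof eventually_elim
      case (elim m)
      have "real (2 ^ m) powr (1 / \<alpha>) = 2 powr (real m / \<alpha>)"
        by (simp add: powr_powr flip: powr_realpow)
      then have "C * r m * real (2 ^ m) powr (1 / \<alpha>) = C * (1 / real m ^ 2)"
        using elim by (simp add: r_def)
      moreover have "0 < r m" using elim by (simp add: r_def)
      ultimately show ?case using C(3)[rule_format, of "r m" "2 ^ m"] elim by simp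
    qed
  qed
  with AE_space[of unit_lebesgue] show ?thesis
  proof eventually_elim
    case (elim x)
    show ?case using elim(2)
    proof eventually_elim
      case (elim m)
      then show ?case using \<open>x \<in> space unit_lebesgue\<close> unfolding r_def mem_Collect_eq by (meson not_less)
    qed
  qed
qed

section \<open>The induced map\<close>

text \<open>The number of steps before the orbit of \<open>y\<close> is in the right half.\<close>

definition depth :: "real \<Rightarrow> nat" where
  "depth y = (LEAST k. grid (Suc k) \<le> y)"

text \<open>Follow the orbit into the right half and then apply the expanding branch once more. This maps each
  \<open>{grid (Suc k)..<grid k}\<close> increasingly onto \<open>{0..<1}\<close>, with the concave inverse \<open>branch k\<close>.\<close>

definition induced :: "real \<Rightarrow> real" where
  "induced y = (f ^^ Suc (depth y)) y"

definition branch :: "nat \<Rightarrow> real \<Rightarrow> real" where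
  "branch k t = (g ^^ k) ((1 + t) / 2)"

lemma branch_0: "branch k 0 = grid (Suc k)" and branch_1: "branch k 1 = grid k"
  using g_iter_grid[of k 1] g_iter_grid[of k 0] by (simp_all add: branch_def grid_1)

lemma branch_mono: "0 \<le> s \<Longrightarrow> s \<le> t \<Longrightarrow> branch k s \<le> branch k t"
  by (simp add: branch_def g_iter_le_iff)

lemma depth_eq: "grid (Suc k) \<le> y \<Longrightarrow> y < grid k \<Longrightarrow> depth y = k"
  unfolding depth_def using grid_mono[of "Suc _" k]
  by (intro Least_equality) (force simp: not_less_eq_eq[symmetric])+

lemma depth_bounds:
  assumes "0 < y" "y < 1"
  shows "grid (Suc (depth y)) \<le> y \<and> y < grid (depth y)"
proof -
  have "\<forall>\<^sub>F k in sequentially. grid k < y" using grid_tendsto_0 assms(1) by (rule order_tendstoD)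
  then obtain k where "grid (Suc k) \<le> y" by (auto simp: eventually_sequentially intro: less_imp_le)
  then have le: "grid (Suc (depth y)) \<le> y" unfolding depth_def by (rule LeastI)
  have "y < grid (depth y)"
  proof (cases "depth y")
    case (Suc i)
    then have "i < (LEAST k. grid (Suc k) \<le> y)" by (simp add: depth_def)
    then have "\<not> grid (Suc i) \<le> y" by (rule not_less_Least)
    then show ?thesis using Suc by simp
  qed (use assms in auto)
  with le show ?thesis by simp
qed

lemma less_grid_iff: "0 < y \<Longrightarrow> y < 1 \<Longrightarrow> y < grid k \<longleftrightarrow> k \<le> depth y"
  using depth_bounds[of y] grid_mono[of k "depth y"] grid_mono[of "Suc (depth y)" k]
  by (cases "k \<le> depth y") (auto simp: not_less_eq_eq)

lemma induced_range: "y \<in> {0..<1} \<Longrightarrow> induced y \<in> {0..<1}"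
  unfolding induced_def by (rule f_iter_range)

lemma depth_measurable: "depth \<in> borel \<rightarrow>\<^sub>M count_space UNIV"
  unfolding depth_def by measurable

lemma induced_measurable: "induced \<in> borel_measurable borel"
proof -
  have "(\<lambda>y. (f ^^ Suc (depth y)) y) \<in> borel_measurable borel"
  proof (rule measurable_compose_countable[where f = "\<lambda>k. f ^^ Suc k" and g = depth])
  qed (rule f_iter_measurable, rule depth_measurable)
  then show ?thesis by (simp add: induced_def[abs_def])
qed

lemma induced_iter_measurable: "(induced ^^ j) \<in> borel_measurable unit_lebesgue"
proof -
  have "(induced ^^ j) \<in> borel_measurable borel"
    by (induction j) (auto simp: o_def intro!: measurable_compose[OF _ induced_measurable])
  then show ?thesis by (rule measurable_unitI)
qed

lemma induced_less_iff:
  assumes y: "grid (Suc k) \<le> y" "y < grid k" and t: "0 \<le> t"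
  shows "induced y < t \<longleftrightarrow> y < branch k t"
proof -
  define z where "z = (f ^^ k) y"
  have y0: "0 \<le> y" using y grid_pos[of "Suc k"] by simp
  have z: "0 \<le> z" "(g ^^ k) z = y" using excursion[OF y0 y(2), of k] by (auto simp: z_def)
  have "(g ^^ k) (1/2) \<le> (g ^^ k) z" using y z g_iter_grid[of k 1] by (simp add: grid_1)
  then have "1/2 \<le> z" using g_iter_le_iff[of "1/2" z k] z(1) by simp
  then have "induced y = 2 * z - 1" using depth_eq[OF y] by (simp add: induced_def z_def f_right)
  then have "induced y < t \<longleftrightarrow> z < (1 + t) / 2" by auto
  also have "\<dots> \<longleftrightarrow> y < branch k t"
    using z t g_iter_less_iff[of z "(1 + t) / 2" k] by (simp add: branch_def)
  finally show ?thesis .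
qed

text \<open>Only countably many points are lost here. On the remaining ones every excursion is finite, so that
  \<open>depth\<close> has its intended meaning along the whole orbit of \<open>induced\<close>; at 0 it is an unspecified
  number.\<close>

definition regular :: "real set" where
  "regular = {x \<in> {0..<1}. \<forall>j. (f ^^ j) x \<noteq> 0}"

definition elapsed :: "nat \<Rightarrow> real \<Rightarrow> nat" where
  "elapsed m x = (\<Sum>i<m. Suc (depth ((induced ^^ i) x)))"

lemma induced_iter_eq: "(induced ^^ m) x = (f ^^ elapsed m x) x"
proof (induction m)
  case (Suc m)
  have "elapsed (Suc m) x = Suc (depth ((induced ^^ m) x)) + elapsed m x" by (simp add: elapsed_def)
  moreover have "(induced ^^ Suc m) x = (f ^^ Suc (depth ((induced ^^ m) x))) ((induced ^^ m) x)" by (simp add: induced_def)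
  ultimately show ?case by (simp only: Suc funpow_add o_apply)
qed (simp add: elapsed_def)

lemma regular_induced_iter: "x \<in> regular \<Longrightarrow> 0 < (induced ^^ m) x \<and> (induced ^^ m) x < 1"
  using f_iter_range[of x "elapsed m x"] by (auto simp: regular_def induced_iter_eq less_le)

lemma finite_f_iter_vimage: "finite {x \<in> {0..<1}. (f ^^ j) x = y}"
proof (induction j)
  case (Suc j)
  have "{x \<in> {0..<1}. (f ^^ Suc j) x = y}
      \<subseteq> (\<Union>z\<in>{z \<in> {0..<1}. (f ^^ j) z = y}. {g z, (1 + z) / 2})"
  proof
    fix x assume x: "x \<in> {x \<in> {0..<1}. (f ^^ Suc j) x = y}"
    then have "f x \<in> {z \<in> {0..<1}. (f ^^ j) z = y}" using f_range[of x] by (auto simp: funpow_swap1)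
    moreover have "x \<in> {g (f x), (1 + f x) / 2}"
      using x by (cases "x < 1/2") (auto simp: f_left f_right g_left_branch)
    ultimately show "x \<in> (\<Union>z\<in>{z \<in> {0..<1}. (f ^^ j) z = y}. {g z, (1 + z) / 2})" by blast
  qed
  then show ?case by (rule finite_subset) (use Suc in auto)
qed (rule finite_subset[of _ "{y}"], auto)

lemma irregular_null: "space unit_lebesgue - regular \<in> null_sets unit_lebesgue"
proof -
  have eq: "space unit_lebesgue - regular = (\<Union>j. {x \<in> {0..<1}. (f ^^ j) x = 0})"
    by (auto simp: regular_def)
  have "countable (\<Union>j. {x \<in> {0..<1}. (f ^^ j) x = 0})"
    using finite_f_iter_vimage by (intro countable_UN) (auto intro: countable_finite)
  then have "(\<Union>j. {x \<in> {0..<1}. (f ^^ j) x = 0}) \<in> null_sets lborel"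
    by (rule countable_imp_null_set_lborel)
  then show ?thesis
    unfolding eq unfolding unit_lebesgue_def by (subst null_sets_restrict_space) auto
qed

lemma sets_regular: "regular \<in> sets unit_lebesgue"
proof -
  have "space unit_lebesgue - (space unit_lebesgue - regular) \<in> sets unit_lebesgue"
    by (rule sets.compl_sets[OF null_setsD2[OF irregular_null]])
  moreover have "space unit_lebesgue - (space unit_lebesgue - regular) = regular"
    by (auto simp: regular_def)
  ultimately show ?thesis by simp
qed

lemma AE_regular: "AE x in unit_lebesgue. x \<in> regular"
  using irregular_null by (rule AE_I') auto

section \<open>Sets whose images have concave distribution functions\<close>

definition induced_cdf :: "nat \<Rightarrow> real set \<Rightarrow> real \<Rightarrow> real" where
  "induced_cdf m S t = measure unit_lebesgue {x \<in> S. (induced ^^ m) x < t}"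

text \<open>The \<open>m\<close>-th image of Lebesgue measure on \<open>S\<close> has a decreasing density. In contrast to bounds on the
  distortion of iterates, this needs no control of derivatives, and it survives when \<open>S\<close> is cut down
  to the points that use prescribed branches.\<close>

definition concave_pushforward :: "nat \<Rightarrow> real set \<Rightarrow> bool" where
  "concave_pushforward m S \<longleftrightarrow> S \<in> sets unit_lebesgue \<and> S \<subseteq> regular \<and> concave_on {0..1} (induced_cdf m S)"

lemma sets_induced_iter_less:
  assumes "S \<in> sets unit_lebesgue"
  shows "{x \<in> S. (induced ^^ m) x < t} \<in> sets unit_lebesgue"
    and "{x \<in> S. s \<le> (induced ^^ m) x \<and> (induced ^^ m) x < t} \<in> sets unit_lebesgue"
proof -
  note [measurable] = induced_iter_measurable
  have "S \<subseteq> space unit_lebesgue" using assms by (rule sets.sets_into_space)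
  then have eq: "{x \<in> S. (induced ^^ m) x < t} = S \<inter> {x \<in> space unit_lebesgue. (induced ^^ m) x < t}"
    "{x \<in> S. s \<le> (induced ^^ m) x \<and> (induced ^^ m) x < t}
      = S \<inter> {x \<in> space unit_lebesgue. s \<le> (induced ^^ m) x \<and> (induced ^^ m) x < t}" by auto
  show "{x \<in> S. (induced ^^ m) x < t} \<in> sets unit_lebesgue"
    unfolding eq by (rule sets.Int[OF assms]) measurable
  show "{x \<in> S. s \<le> (induced ^^ m) x \<and> (induced ^^ m) x < t} \<in> sets unit_lebesgue"
    unfolding eq by (rule sets.Int[OF assms]) measurable
qed

lemma induced_cdf_diff:
  assumes S: "S \<in> sets unit_lebesgue" and "s \<le> t"
  shows "measure unit_lebesgue {x \<in> S. s \<le> (induced ^^ m) x \<and> (induced ^^ m) x < t} = induced_cdf m S t - induced_cdf m S s"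
proof -
  let ?A = "\<lambda>t. {x \<in> S. (induced ^^ m) x < t}"
  have eq: "{x \<in> S. s \<le> (induced ^^ m) x \<and> (induced ^^ m) x < t} = ?A t - ?A s" by auto
  have "?A s \<subseteq> ?A t" using assms by auto
  then show ?thesis unfolding induced_cdf_def eq
    by (rule U.finite_measure_Diff[OF sets_induced_iter_less(1)[OF S] sets_induced_iter_less(1)[OF S]])
qed

lemma induced_cdf_mono: "S \<in> sets unit_lebesgue \<Longrightarrow> s \<le> t \<Longrightarrow> induced_cdf m S s \<le> induced_cdf m S t"
  unfolding induced_cdf_def by (intro U.finite_measure_mono sets_induced_iter_less) auto

lemma induced_cdf_1: "S \<subseteq> regular \<Longrightarrow> induced_cdf m S 1 = measure unit_lebesgue S"
  using regular_induced_iter unfolding induced_cdf_def by (intro arg_cong[of _ _ "measure unit_lebesgue"]) auto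

lemma concave_pushforward_regular: "concave_pushforward 0 regular"
proof -
  have "induced_cdf 0 regular t = t" if "t \<in> {0..1}" for t
  proof -
    let ?A = "{x \<in> space unit_lebesgue. x < t}"
    have "{x \<in> regular. (induced ^^ 0) x < t} = ?A - (space unit_lebesgue - regular)"
      by (auto simp: regular_def)
    moreover have "measure unit_lebesgue (?A - (space unit_lebesgue - regular)) = measure unit_lebesgue ?A"
      using sets_f_iter_less[of 0 t] by (intro measure_Diff_null_set irregular_null) (simp del: space_unit)
    ultimately show ?thesis using that measure_unit_less[of t] by (simp only: induced_cdf_def) auto
  qed
  then have "concave_on {0..1} (induced_cdf 0 regular)"
    using concave_on_eqI[of "{0..1}" "\<lambda>t. t" "induced_cdf 0 regular"] by (simp add: concave_on_ident)
  then show ?thesis by (simp add: concave_pushforward_def sets_regular)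
qed

lemma concave_pushforward_empty: "concave_pushforward m {}"
  by (simp add: concave_pushforward_def induced_cdf_def[abs_def] concave_on_const)

lemma concave_on_branch: "concave_on {0..1} (branch k)"
proof -
  have "concave_on {0..1::real} (\<lambda>t. (1 + t) / 2)"
    by (intro concave_on_cdiv concave_on_add) (auto simp: concave_on_ident concave_on_const)
  then show ?thesis unfolding branch_def[abs_def]
    by (rule concave_on_compose_mono[OF concave_on_g_iter])
      (auto simp: g_iter_le_iff intro!: mono_onI)
qed

text \<open>Restricting to one branch and applying \<open>induced\<close> once composes the distribution function with the
  inverse branch.\<close>

lemma induced_cdf_branch:
  assumes S: "S \<in> sets unit_lebesgue" and t: "0 \<le> t" "t \<le> 1"
  shows "induced_cdf (Suc m) {x \<in> S. grid (Suc k) \<le> (induced ^^ m) x \<and> (induced ^^ m) x < grid k} t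
       = induced_cdf m S (branch k t) - induced_cdf m S (grid (Suc k))"
proof -
  have b: "grid (Suc k) \<le> branch k t" "branch k t \<le> grid k"
    using t branch_mono[of 0 t k] branch_mono[of t 1 k] by (auto simp: branch_0 branch_1)
  have "{x \<in> {x \<in> S. grid (Suc k) \<le> (induced ^^ m) x \<and> (induced ^^ m) x < grid k}. (induced ^^ Suc m) x < t}
      = {x \<in> S. grid (Suc k) \<le> (induced ^^ m) x \<and> (induced ^^ m) x < branch k t}"
    using b induced_less_iff[of k _ t] t by auto
  then show ?thesis unfolding induced_cdf_def[of "Suc m"] using induced_cdf_diff[OF S b(1)] by simp
qed

lemma concave_pushforward_branch:
  assumes "concave_pushforward m S"
  shows "concave_pushforward (Suc m) {x \<in> S. grid (Suc k) \<le> (induced ^^ m) x \<and> (induced ^^ m) x < grid k}"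
proof -
  have S: "S \<in> sets unit_lebesgue" "S \<subseteq> regular" "concave_on {0..1} (induced_cdf m S)"
    using assms by (auto simp: concave_pushforward_def)
  have "branch k t \<in> {0..1}" if "t \<in> {0..1}" for t
    using that branch_mono[of 0 t k] branch_mono[of t 1 k] grid_pos[of "Suc k"] grid_le_1[of k]
    by (auto simp: branch_0 branch_1)
  then have "concave_on {0..1} (\<lambda>t. induced_cdf m S (branch k t))"
    by (intro concave_on_compose_mono[OF S(3) concave_on_branch])
      (auto intro!: mono_onI induced_cdf_mono S(1))
  then have "concave_on {0..1} (\<lambda>t. induced_cdf m S (branch k t) - induced_cdf m S (grid (Suc k)))"
    by (intro concave_on_diff) (auto simp: convex_on_const)
  then have "concave_on {0..1} (induced_cdf (Suc m) {x \<in> S. grid (Suc k) \<le> (induced ^^ m) x \<and> (induced ^^ m) x < grid k})"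
    by (rule concave_on_eqI) (simp add: induced_cdf_branch[OF S(1)])
  then show ?thesis using S sets_induced_iter_less(2)[OF S(1)] by (auto simp: concave_pushforward_def)
qed

lemma concave_pushforward_UN:
  fixes S :: "nat \<Rightarrow> real set"
  assumes S: "\<And>k. concave_pushforward m (S k)" and disj: "disjoint_family S"
  shows "concave_pushforward m (\<Union>k. S k)"
proof -
  have sets: "S k \<in> sets unit_lebesgue" for k using S by (simp add: concave_pushforward_def)
  have "concave_on {0..1} (induced_cdf m (\<Union>k. S k))"
  proof (rule concave_on_suminf)
    show "concave_on {0..1} (induced_cdf m (S k))" for k using S by (simp add: concave_pushforward_def)
    fix t
    have "(\<lambda>k. measure unit_lebesgue {x \<in> S k. (induced ^^ m) x < t}) sums
        measure unit_lebesgue (\<Union>k. {x \<in> S k. (induced ^^ m) x < t})"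
    proof (rule U.finite_measure_UNION)
      show "disjoint_family (\<lambda>k. {x \<in> S k. (induced ^^ m) x < t})"
        using disj unfolding disjoint_family_on_def by blast
    qed (use sets_induced_iter_less(1)[OF sets] in auto)
    moreover have "(\<Union>k. {x \<in> S k. (induced ^^ m) x < t}) = {x \<in> (\<Union>k. S k). (induced ^^ m) x < t}" by auto
    ultimately show "(\<lambda>k. induced_cdf m (S k) t) sums induced_cdf m (\<Union>k. S k) t" by (simp add: induced_cdf_def)
  qed
  moreover have "(\<Union>k. S k) \<in> sets unit_lebesgue" using sets by auto
  ultimately show ?thesis using S by (auto simp: concave_pushforward_def)
qed

text \<open>Inside \<open>{0<..<1}\<close>, membership in \<open>V\<close> depends only on the branches used in the next \<open>q\<close> steps of
  \<open>induced\<close>: \<open>V\<close> is a union of cylinders of order \<open>q\<close>. The recursion is over the first branch.\<close>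

primrec cylinder_union :: "nat \<Rightarrow> real set \<Rightarrow> bool" where
  "cylinder_union 0 V \<longleftrightarrow> {0<..<1} \<subseteq> V \<or> V \<inter> {0<..<1} = {}"
| "cylinder_union (Suc q) V \<longleftrightarrow> (\<forall>k. \<exists>W. cylinder_union q W \<and>
     (\<forall>y. grid (Suc k) \<le> y \<and> y < grid k \<longrightarrow> (y \<in> V \<longleftrightarrow> induced y \<in> W)))"

text \<open>By induction on \<open>q\<close>: split \<open>S\<close> according to the first branch, which takes one step of \<open>induced\<close>, and
  add up the countably many concave distribution functions.\<close>

lemma concave_pushforward_cylinder_union:
  "concave_pushforward m S \<Longrightarrow> cylinder_union q V \<Longrightarrow>
    concave_pushforward (m + q) {x \<in> S. (induced ^^ m) x \<in> V}"
proof (induction q arbitrary: m S V)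
  case 0
  have "0 < (induced ^^ m) x" "(induced ^^ m) x < 1" if "x \<in> S" for x
    using 0 that regular_induced_iter by (auto simp: concave_pushforward_def)
  then have "{x \<in> S. (induced ^^ m) x \<in> V} = S \<or> {x \<in> S. (induced ^^ m) x \<in> V} = {}"
    using 0 by auto
  then show ?case using 0 concave_pushforward_empty by (metis add_0_right)
next
  case (Suc q)
  obtain W where W: "\<And>k. cylinder_union q (W k)"
    "\<And>k y. grid (Suc k) \<le> y \<Longrightarrow> y < grid k \<Longrightarrow> y \<in> V \<longleftrightarrow> induced y \<in> W k"
    using Suc.prems(2) unfolding cylinder_union.simps by metis
  define I where "I k = {x \<in> S. grid (Suc k) \<le> (induced ^^ m) x \<and> (induced ^^ m) x < grid k}" for k
  have "concave_pushforward (Suc m + q) {x \<in> I k. (induced ^^ Suc m) x \<in> W k}" for k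
    unfolding I_def by (intro Suc.IH concave_pushforward_branch Suc.prems W)
  moreover have "disjoint_family (\<lambda>k. {x \<in> I k. (induced ^^ Suc m) x \<in> W k})"
    unfolding disjoint_family_on_def I_def using depth_eq by blast
  ultimately have "concave_pushforward (Suc m + q) (\<Union>k. {x \<in> I k. (induced ^^ Suc m) x \<in> W k})"
    by (intro concave_pushforward_UN)
  moreover have "(\<Union>k. {x \<in> I k. (induced ^^ Suc m) x \<in> W k}) = {x \<in> S. (induced ^^ m) x \<in> V}"
  proof -
    have "0 < (induced ^^ m) x" "(induced ^^ m) x < 1" if "x \<in> S" for x
      using Suc.prems(1) that regular_induced_iter by (auto simp: concave_pushforward_def)
    then show ?thesis using depth_bounds W(2) by (auto simp: I_def) blast
  qed
  ultimately show ?case by simp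
qed

lemma cylinder_union_UNIV: "cylinder_union q UNIV"
  by (induction q) auto

lemma cylinder_union_Compl: "cylinder_union q V \<Longrightarrow> cylinder_union q (- V)"
proof (induction q arbitrary: V)
  case (Suc q)
  then show ?case unfolding cylinder_union.simps by (metis ComplD ComplI)
qed auto

lemma cylinder_union_Int: "cylinder_union q V \<Longrightarrow> cylinder_union q V' \<Longrightarrow> cylinder_union q (V \<inter> V')"
proof (induction q arbitrary: V V')
  case (Suc q)
  show ?case unfolding cylinder_union.simps
  proof
    fix k
    obtain W where W: "cylinder_union q W" "\<forall>y. grid (Suc k) \<le> y \<and> y < grid k \<longrightarrow> (y \<in> V \<longleftrightarrow> induced y \<in> W)"
      using Suc.prems(1) by auto
    obtain W' where W': "cylinder_union q W'" "\<forall>y. grid (Suc k) \<le> y \<and> y < grid k \<longrightarrow> (y \<in> V' \<longleftrightarrow> induced y \<in> W')"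
      using Suc.prems(2) by auto
    show "\<exists>W. cylinder_union q W \<and> (\<forall>y. grid (Suc k) \<le> y \<and> y < grid k \<longrightarrow> (y \<in> V \<inter> V' \<longleftrightarrow> induced y \<in> W))"
      using W W' Suc.IH[OF W(1) W'(1)] by (intro exI[of _ "W \<inter> W'"]) auto
  qed
qed auto

lemma concave_pushforward_Suc: "concave_pushforward m S \<Longrightarrow> concave_pushforward (Suc m) S"
  using concave_pushforward_cylinder_union[of m S 1 UNIV] cylinder_union_UNIV[of 1] by simp

lemma concave_pushforward_regular_all: "concave_pushforward m regular"
  by (induction m) (auto intro: concave_pushforward_regular concave_pushforward_Suc)

section \<open>Independence of the next step up to constants\<close>

lemma induced_cdf_next_sums:
  assumes S: "S \<in> sets unit_lebesgue" "S \<subseteq> regular" and t: "0 \<le> s" "s \<le> t" "t \<le> 1"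
  shows "(\<lambda>k. induced_cdf m S (branch k t) - induced_cdf m S (branch k s)) sums
    measure unit_lebesgue {x \<in> S. s \<le> (induced ^^ Suc m) x \<and> (induced ^^ Suc m) x < t}"
proof -
  define A where "A k = {x \<in> S. branch k s \<le> (induced ^^ m) x \<and> (induced ^^ m) x < branch k t}" for k
  have iff: "x \<in> A k \<longleftrightarrow> x \<in> S \<and> grid (Suc k) \<le> (induced ^^ m) x \<and> (induced ^^ m) x < grid k
      \<and> s \<le> (induced ^^ Suc m) x \<and> (induced ^^ Suc m) x < t" for x k
    using t branch_mono[of 0 s k] branch_mono[of t 1 k] induced_less_iff[of k "(induced ^^ m) x" s]
      induced_less_iff[of k "(induced ^^ m) x" t] unfolding A_def by (auto simp: branch_0 branch_1 not_less[symmetric])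
  have "(\<lambda>k. measure unit_lebesgue (A k)) sums measure unit_lebesgue (\<Union>k. A k)"
  proof (rule U.finite_measure_UNION)
    show "range A \<subseteq> sets unit_lebesgue" unfolding A_def using sets_induced_iter_less(2)[OF S(1)] by auto
    show "disjoint_family A" unfolding disjoint_family_on_def using iff depth_eq by blast
  qed
  moreover have "measure unit_lebesgue (A k) = induced_cdf m S (branch k t) - induced_cdf m S (branch k s)" for k
    unfolding A_def using t by (intro induced_cdf_diff S branch_mono) auto
  moreover have "(\<Union>k. A k) = {x \<in> S. s \<le> (induced ^^ Suc m) x \<and> (induced ^^ Suc m) x < t}"
  proof -
    have "0 < (induced ^^ m) x" "(induced ^^ m) x < 1" if "x \<in> S" for x
      using S that regular_induced_iter by auto
    then show ?thesis using depth_bounds iff by blast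
  qed
  ultimately show ?thesis by simp
qed

text \<open>The value at 0 in the telescoping sums below; it holds because no regular point is ever mapped
  to 0.\<close>

lemma induced_cdf_grid_tendsto_0:
  assumes S: "S \<in> sets unit_lebesgue" "S \<subseteq> regular"
  shows "(\<lambda>k. induced_cdf m S (grid k)) \<longlonglongrightarrow> 0"
proof -
  have "(\<lambda>k. induced_cdf m S (grid k)) \<longlonglongrightarrow> measure unit_lebesgue (\<Inter>k. {x \<in> S. (induced ^^ m) x < grid k})"
    unfolding induced_cdf_def
  proof (rule U.finite_Lim_measure_decseq)
    show "decseq (\<lambda>k. {x \<in> S. (induced ^^ m) x < grid k})"
      unfolding decseq_def using grid_mono by (auto intro: less_le_trans)
  qed (use sets_induced_iter_less(1)[OF S(1)] in auto)
  moreover have "(\<Inter>k. {x \<in> S. (induced ^^ m) x < grid k}) = {}"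
  proof -
    have "\<exists>k. grid k \<le> (induced ^^ m) x" if "x \<in> S" for x
      using S that regular_induced_iter[of x m] depth_bounds by blast
    then show ?thesis by (auto simp: not_le[symmetric])
  qed
  ultimately show ?thesis by simp
qed

text \<open>The constants of the next two comparisons: \<open>2 powr \<alpha>\<close> is \<open>left_branch 1 - 1\<close>, the length of the chord to
  the right of 1, \<open>1/2 - grid 2\<close> is the length of the chord to the left of \<open>1/2\<close>, and the factor 2 is
  the slope of the right branch.\<close>

definition density_lower :: real where "density_lower = 1 / (2 * 2 powr \<alpha>)"
definition density_upper :: real where "density_upper = 1 / (1 - 2 * grid 2)"

lemma density_lower_pos: "0 < density_lower" by (simp add: density_lower_def)

lemma density_lower_le_1: "density_lower \<le> 1"
  using ge_one_powr_ge_zero[of 2 \<alpha>] alpha by (simp add: density_lower_def)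

lemma density_upper_ge_1: "1 \<le> density_upper"
  using grid_Suc_less[of 1] grid_pos[of 2] by (simp add: density_upper_def grid_1 numeral_2_eq_2)

text \<open>On branch \<open>Suc k\<close> the piece mapped into \<open>{s..<t}\<close> is compared with the interval
  \<open>{grid (Suc k)..<grid k}\<close> to its right. The inverse branch is steeper on the piece, so the piece is at
  least \<open>density_lower * (t - s)\<close> times as long as that interval, and the density on it is larger.
  Summing over \<open>k\<close>, the neighbouring intervals exhaust the unit interval.\<close>

lemma next_measure_ge:
  assumes S: "concave_pushforward m S" and t: "0 \<le> s" "s \<le> t" "t \<le> 1"
  shows "density_lower * (t - s) * measure unit_lebesgue S
      \<le> measure unit_lebesgue {x \<in> S. s \<le> (induced ^^ Suc m) x \<and> (induced ^^ Suc m) x < t}"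
proof (cases "s = t")
  case False
  have S: "S \<in> sets unit_lebesgue" "S \<subseteq> regular" "concave_on {0..1} (induced_cdf m S)"
    using assms by (auto simp: concave_pushforward_def)
  let ?F = "induced_cdf m S" and ?R = "measure unit_lebesgue {x \<in> S. s \<le> (induced ^^ Suc m) x \<and> (induced ^^ Suc m) x < t}"
  have sums: "(\<lambda>k. ?F (branch k t) - ?F (branch k s)) sums ?R"
    by (rule induced_cdf_next_sums[OF S(1,2) t])
  have "(\<lambda>k. ?F (grid k) - ?F (grid (Suc k))) sums (?F (grid 0) - 0)"
    by (rule telescope_sums'[OF induced_cdf_grid_tendsto_0[OF S(1,2)]])
  then have tele: "(\<lambda>k. density_lower * (t - s) * (?F (grid k) - ?F (grid (Suc k)))) sums (density_lower * (t - s) * measure unit_lebesgue S)"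
    by (intro sums_mult) (simp add: induced_cdf_1[OF S(2)])
  have tail: "(\<lambda>k. ?F (branch (Suc k) t) - ?F (branch (Suc k) s)) sums (?R - (?F (branch 0 t) - ?F (branch 0 s)))"
    using sums by (subst sums_Suc_iff) simp
  have "density_lower * (t - s) * measure unit_lebesgue S \<le> ?R - (?F (branch 0 t) - ?F (branch 0 s))"
  proof (rule sums_le[OF _ tele tail])
    fix k
    define a where "a = branch (Suc k) s"
    define b where "b = branch (Suc k) t"
    have ab: "0 < a" "a < b" "b \<le> grid (Suc k)"
      using t False branch_mono[of 0 s "Suc k"] branch_mono[of t 1 "Suc k"] grid_pos[of "Suc (Suc k)"]
      by (auto simp: a_def b_def branch_0 branch_1) (simp add: branch_def g_iter_less_iff del: funpow.simps)
    \<comment> \<open>the chord of \<open>g ^^ Suc k\<close> to the right of 1 ends at the point that is mapped to \<open>grid k\<close>\<close>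
    have "((g ^^ Suc k) (left_branch 1) - (g ^^ Suc k) 1) * ((1 + t) / 2 - (1 + s) / 2)
        \<le> ((g ^^ Suc k) ((1 + t) / 2) - (g ^^ Suc k) ((1 + s) / 2)) * (left_branch 1 - 1)"
      using t False by (intro concave_on_slopes[OF concave_on_g_iter]) (auto simp: left_branch_1)
    moreover have "(g ^^ Suc k) (left_branch 1) = grid k"
      using g_left_branch[of 1] by (simp add: grid_def funpow_Suc_right del: funpow.simps)
    ultimately have 1: "(grid k - grid (Suc k)) * ((t - s) / 2) \<le> (b - a) * 2 powr \<alpha>"
      by (simp add: a_def b_def branch_def grid_def left_branch_1 diff_divide_distrib add_divide_distrib del: funpow.simps)
    have d: "0 < grid k - grid (Suc k)" using grid_Suc_less[of k] by simp
    have inc: "0 \<le> ?F (grid k) - ?F (grid (Suc k))" using induced_cdf_mono[OF S(1)] d by simp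
    have 2: "(?F (grid k) - ?F (grid (Suc k))) * (b - a) \<le> (?F b - ?F a) * (grid k - grid (Suc k))"
      using ab d grid_le_1[of k] grid_pos[of k] by (intro concave_on_slopes[OF S(3)]) auto
    have "density_lower * (t - s) * (grid k - grid (Suc k)) \<le> b - a"
      using 1 by (simp add: density_lower_def field_simps)
    then have "(?F (grid k) - ?F (grid (Suc k))) * (density_lower * (t - s) * (grid k - grid (Suc k)))
        \<le> (?F (grid k) - ?F (grid (Suc k))) * (b - a)"
      using inc by (intro mult_left_mono)
    with 2 have "(density_lower * (t - s) * (?F (grid k) - ?F (grid (Suc k)))) * (grid k - grid (Suc k))
        \<le> (?F b - ?F a) * (grid k - grid (Suc k))" by (simp add: algebra_simps)
    then show "density_lower * (t - s) * (?F (grid k) - ?F (grid (Suc k))) \<le> ?F (branch (Suc k) t) - ?F (branch (Suc k) s)"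
      using d unfolding a_def b_def by (simp only: mult_le_cancel_right)
  qed
  moreover have "?F (branch 0 s) \<le> ?F (branch 0 t)"
    using t by (intro induced_cdf_mono S branch_mono) auto
  ultimately show ?thesis by simp
qed (simp)

text \<open>As in \<open>next_measure_ge\<close>, now comparing the piece on branch \<open>k\<close> with the interval
  \<open>{grid (Suc (Suc k))..<grid (Suc k)}\<close> to its left.\<close>

lemma next_measure_le:
  assumes S: "concave_pushforward m S" and t: "0 \<le> s" "s \<le> t" "t \<le> 1"
  shows "measure unit_lebesgue {x \<in> S. s \<le> (induced ^^ Suc m) x \<and> (induced ^^ Suc m) x < t}
      \<le> density_upper * (t - s) * measure unit_lebesgue S"
proof -
  have S: "S \<in> sets unit_lebesgue" "S \<subseteq> regular" "concave_on {0..1} (induced_cdf m S)"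
    using assms by (auto simp: concave_pushforward_def)
  let ?F = "induced_cdf m S" and ?R = "measure unit_lebesgue {x \<in> S. s \<le> (induced ^^ Suc m) x \<and> (induced ^^ Suc m) x < t}"
  have sums: "(\<lambda>k. ?F (branch k t) - ?F (branch k s)) sums ?R"
    by (rule induced_cdf_next_sums[OF S(1,2) t])
  have "(\<lambda>k. ?F (grid (Suc k)) - ?F (grid (Suc (Suc k)))) sums (?F (grid (Suc 0)) - 0)"
    by (rule telescope_sums'[OF LIMSEQ_Suc[OF induced_cdf_grid_tendsto_0[OF S(1,2)]]])
  then have tele: "(\<lambda>k. density_upper * (t - s) * (?F (grid (Suc k)) - ?F (grid (Suc (Suc k))))) sums (density_upper * (t - s) * ?F (1/2))"
    by (intro sums_mult) (simp add: grid_1)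
  have "?R \<le> density_upper * (t - s) * ?F (1/2)"
  proof (rule sums_le[OF _ sums tele])
    fix k
    define a where "a = branch k s"
    define b where "b = branch k t"
    have ab: "grid (Suc k) \<le> a" "a \<le> b" "b \<le> 1"
      using t branch_mono[of 0 s k] branch_mono[of s t k] branch_mono[of t 1 k] grid_le_1[of k]
      by (auto simp: a_def b_def branch_0 branch_1)
    have g2: "grid 2 < 1/2" using grid_Suc_less[of 1] by (simp add: grid_1 numeral_2_eq_2)
    \<comment> \<open>the chord to the left of \<open>1/2\<close> starts at \<open>grid 2\<close>, the preimage of \<open>1/2\<close>\<close>
    have "((g ^^ k) ((1 + t) / 2) - (g ^^ k) ((1 + s) / 2)) * (1/2 - grid 2)
        \<le> ((g ^^ k) (1/2) - (g ^^ k) (grid 2)) * ((1 + t) / 2 - (1 + s) / 2)"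
      using t g2 grid_pos[of 2] by (intro concave_on_slopes[OF concave_on_g_iter]) auto
    then have 1: "(b - a) * (1/2 - grid 2) \<le> (grid (Suc k) - grid (Suc (Suc k))) * ((t - s) / 2)"
      using g_iter_grid[of k 1] g_iter_grid[of k 2]
      by (simp add: a_def b_def branch_def grid_1 diff_divide_distrib add_divide_distrib)
    have d: "0 < grid (Suc k) - grid (Suc (Suc k))" using grid_Suc_less[of "Suc k"] by simp
    have inc: "0 \<le> ?F (grid (Suc k)) - ?F (grid (Suc (Suc k)))" using induced_cdf_mono[OF S(1)] d by simp
    have 2: "(?F b - ?F a) * (grid (Suc k) - grid (Suc (Suc k)))
        \<le> (?F (grid (Suc k)) - ?F (grid (Suc (Suc k)))) * (b - a)"
      using ab d grid_pos[of "Suc (Suc k)"] grid_le_1[of "Suc (Suc k)"]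
      by (intro concave_on_slopes[OF S(3)]) auto
    have "b - a \<le> density_upper * (t - s) * (grid (Suc k) - grid (Suc (Suc k)))"
      using 1 g2 by (simp add: density_upper_def field_simps)
    then have "(?F (grid (Suc k)) - ?F (grid (Suc (Suc k)))) * (b - a)
        \<le> (?F (grid (Suc k)) - ?F (grid (Suc (Suc k)))) * (density_upper * (t - s) * (grid (Suc k) - grid (Suc (Suc k))))"
      using inc by (intro mult_left_mono)
    with 2 have "(?F b - ?F a) * (grid (Suc k) - grid (Suc (Suc k)))
        \<le> (density_upper * (t - s) * (?F (grid (Suc k)) - ?F (grid (Suc (Suc k))))) * (grid (Suc k) - grid (Suc (Suc k)))"
      by (simp add: algebra_simps)
    then show "?F (branch k t) - ?F (branch k s) \<le> density_upper * (t - s) * (?F (grid (Suc k)) - ?F (grid (Suc (Suc k))))"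
      using d unfolding a_def b_def by (simp only: mult_le_cancel_right)
  qed
  also have "\<dots> \<le> density_upper * (t - s) * ?F 1"
    using t density_upper_ge_1 by (intro mult_left_mono induced_cdf_mono S) auto
  finally show ?thesis by (simp add: induced_cdf_1[OF S(2)])
qed

section \<open>The probability of missing a target\<close>

lemma measure_regular: "measure unit_lebesgue regular = 1"
proof -
  have "measure unit_lebesgue ({x \<in> space unit_lebesgue. x < 1} - (space unit_lebesgue - regular)) = 1"
    using measure_unit_less[of 1] sets_f_iter_less[of 0 1]
    by (subst measure_Diff_null_set[OF _ irregular_null]) (simp_all del: space_unit)
  moreover have "{x \<in> space unit_lebesgue. x < 1} - (space unit_lebesgue - regular) = regular"
    by (auto simp: regular_def)
  ultimately show ?thesis by simp
qed

lemma induced_cdf_regular_le: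
  assumes t: "0 \<le> t" "t \<le> 1"
  shows "induced_cdf i regular t \<le> density_upper * t"
proof (cases i)
  case 0
  have "induced_cdf 0 regular t \<le> measure unit_lebesgue {x \<in> space unit_lebesgue. x < t}"
    unfolding induced_cdf_def using sets_f_iter_less[of 0 t]
    by (intro U.finite_measure_mono) (auto simp: regular_def)
  also have "\<dots> = t" using t by (rule measure_unit_less)
  also have "\<dots> \<le> density_upper * t" using mult_right_mono[OF density_upper_ge_1 t(1)] by simp
  finally show ?thesis using 0 by simp
next
  case (Suc m)
  have "{x \<in> regular. (induced ^^ Suc m) x < t} = {x \<in> regular. 0 \<le> (induced ^^ Suc m) x \<and> (induced ^^ Suc m) x < t}"
    using regular_induced_iter[of _ "Suc m"] by (auto intro: less_imp_le simp del: funpow.simps)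
  then show ?thesis
    using next_measure_le[OF concave_pushforward_regular_all[of m], of 0 t] t
    by (simp add: Suc induced_cdf_def measure_regular del: funpow.simps)
qed

text \<open>The target is tested at every \<open>Suc q\<close>-th step. Whether it is hit is known \<open>q\<close> steps later, so the set of
  survivors is again of the kind to which \<open>next_measure_ge\<close> applies; the extra step is the one in which
  that lemma makes the density bounded below.\<close>

lemma survival_bound:
  assumes V: "cylinder_union q {y. s \<le> y \<and> y < t}" and t: "0 \<le> s" "s \<le> t" "t \<le> 1"
  defines "surv \<equiv> \<lambda>M. {x \<in> regular. \<forall>j<M. \<not> (s \<le> (induced ^^ Suc (j * Suc q)) x \<and> (induced ^^ Suc (j * Suc q)) x < t)}"
  shows "concave_pushforward (M * Suc q) (surv M) \<and> measure unit_lebesgue (surv M) \<le> (1 - density_lower * (t - s)) ^ M"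
proof (induction M)
  case 0
  then show ?case by (simp add: surv_def measure_regular concave_pushforward_regular)
next
  case (Suc M)
  let ?V = "{y. s \<le> y \<and> y < t}" and ?m = "M * Suc q"
  let ?hit = "{x \<in> surv M. s \<le> (induced ^^ Suc ?m) x \<and> (induced ^^ Suc ?m) x < t}"
  have concave_pushforward: "concave_pushforward ?m (surv M)" using Suc by blast
  then have sets: "surv M \<in> sets unit_lebesgue" by (simp add: concave_pushforward_def)
  have step: "surv (Suc M) = {x \<in> surv M. (induced ^^ Suc ?m) x \<in> - ?V}"
    unfolding surv_def less_Suc_eq by blast
  have "concave_pushforward (Suc ?m + q) (surv (Suc M))"
    unfolding step by (intro concave_pushforward_cylinder_union concave_pushforward_Suc concave_pushforward cylinder_union_Compl V)
  then have 1: "concave_pushforward (Suc M * Suc q) (surv (Suc M))" by (simp add: add.commute add.left_commute)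
  have "surv (Suc M) = surv M - ?hit" unfolding step by auto
  also have "measure unit_lebesgue \<dots> = measure unit_lebesgue (surv M) - measure unit_lebesgue ?hit"
    by (intro U.finite_measure_Diff sets sets_induced_iter_less) auto
  also have "\<dots> \<le> measure unit_lebesgue (surv M) - density_lower * (t - s) * measure unit_lebesgue (surv M)"
    using next_measure_ge[OF concave_pushforward t] by simp
  also have "\<dots> = measure unit_lebesgue (surv M) * (1 - density_lower * (t - s))" by (simp add: algebra_simps)
  also have "\<dots> \<le> (1 - density_lower * (t - s)) ^ M * (1 - density_lower * (t - s))"
  proof (rule mult_right_mono)
    have "density_lower * (t - s) \<le> 1 * 1" using t density_lower_pos density_lower_le_1 by (intro mult_mono) auto
    then show "0 \<le> 1 - density_lower * (t - s)" by simp
  qed (use Suc in blast)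
  also have "\<dots> = (1 - density_lower * (t - s)) ^ Suc M" by simp
  finally show ?case using 1 by blast
qed

text \<open>Excursions have no finite mean, so they are truncated at \<open>n\<close>: if the first \<open>N\<close> excursions take \<open>n\<close> steps
  in total, so do the truncated ones. A truncated excursion has length \<open>\<Sum>k<n. indicator {y. y < grid k}\<close>,
  whose mean is bounded by \<open>induced_cdf_regular_le\<close>. Then apply Markov's inequality.\<close>

lemma elapsed_bound:
  assumes n: "0 < n"
  shows "measure unit_lebesgue {x \<in> regular. n \<le> elapsed N x} \<le> density_upper * real N / real n * (\<Sum>k<n. grid k)"
proof -
  define A where "A i k = {x \<in> regular. (induced ^^ i) x < grid k}" for i k
  define u where "u x = (\<Sum>i<N. \<Sum>k<n. indicat_real (A i k) x)" for x
  have A: "A i k \<in> sets unit_lebesgue" for i k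
    unfolding A_def by (rule sets_induced_iter_less(1)[OF sets_regular])
  have int: "integrable unit_lebesgue u"
    unfolding u_def using A by (intro Bochner_Integration.integrable_sum) (auto simp: less_top[symmetric])
  have "(\<integral>x. u x \<partial>unit_lebesgue) = (\<Sum>i<N. \<Sum>k<n. measure unit_lebesgue (A i k))"
    unfolding u_def using A
    by (subst Bochner_Integration.integral_sum; (intro sum.cong refl)?)+
       (auto intro!: Bochner_Integration.integrable_sum sum.cong arg_cong[of _ _ "measure unit_lebesgue"]
          simp: A_def regular_def less_top[symmetric])
  also have "\<dots> \<le> (\<Sum>i<N. \<Sum>k<n. density_upper * grid k)"
    using induced_cdf_regular_le[OF less_imp_le[OF grid_pos] grid_le_1]
    by (intro sum_mono) (simp add: A_def induced_cdf_def)
  also have "\<dots> = density_upper * real N * (\<Sum>k<n. grid k)" by (simp add: sum_distrib_left mult_ac)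
  finally have integral: "(\<integral>x. u x \<partial>unit_lebesgue) \<le> density_upper * real N * (\<Sum>k<n. grid k)" .
  have u: "real n \<le> u x" if x: "x \<in> regular" "n \<le> elapsed N x" for x
  proof -
    define a where "a i = Suc (depth ((induced ^^ i) x))" for i
    have inner: "(\<Sum>k<n. indicat_real (A i k) x) = real (min n (a i))" for i
    proof -
      have "(\<Sum>k<n. indicat_real (A i k) x) = (\<Sum>k<n. if k < a i then 1 else 0)"
        using x regular_induced_iter[OF x(1), of i] less_grid_iff[of "(induced ^^ i) x"]
        by (intro sum.cong) (auto simp: A_def a_def less_Suc_eq_le)
      also have "\<dots> = real (card {k. k < n \<and> k < a i})"
        by (simp add: sum.If_cases lessThan_def Collect_conj_eq)
      also have "{k. k < n \<and> k < a i} = {..<min n (a i)}" by auto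
      finally show ?thesis by simp
    qed
    \<comment> \<open>one excursion of length at least \<open>n\<close> is enough; otherwise nothing is truncated\<close>
    have "n \<le> (\<Sum>i<N. min n (a i))"
    proof (cases "\<exists>i<N. n \<le> a i")
      case True
      then obtain i where i: "i < N" "n \<le> a i" by blast
      then have "n = min n (a i)" by simp
      also have "\<dots> \<le> (\<Sum>i<N. min n (a i))" using i by (intro member_le_sum) auto
      finally show ?thesis .
    next
      case False
      then have "(\<Sum>i<N. min n (a i)) = (\<Sum>i<N. a i)" by (intro sum.cong) auto
      then show ?thesis using x(2) by (simp add: elapsed_def a_def)
    qed
    then show ?thesis unfolding u_def inner using of_nat_mono by fastforce
  qed
  have "measure unit_lebesgue {x \<in> regular. n \<le> elapsed N x}
      \<le> measure unit_lebesgue {x \<in> space unit_lebesgue. real n \<le> u x}"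
  proof (rule U.finite_measure_mono)
    show "{x \<in> regular. n \<le> elapsed N x} \<subseteq> {x \<in> space unit_lebesgue. real n \<le> u x}"
      using u by (auto simp: regular_def)
    show "{x \<in> space unit_lebesgue. real n \<le> u x} \<in> sets unit_lebesgue"
      using borel_measurable_integrable[OF int] by measurable
  qed
  also have "\<dots> \<le> (\<integral>x. u x \<partial>unit_lebesgue) / real n"
    by (rule integral_Markov_inequality_measure[OF int sets.top]) (use n in \<open>auto simp: u_def intro!: sum_nonneg\<close>)
  also have "\<dots> \<le> density_upper * real N * (\<Sum>k<n. grid k) / real n"
    using integral by (intro divide_right_mono) auto
  finally show ?thesis by simp
qed

text \<open>Either the induced orbit misses the target in all \<open>M\<close> tests, or these tests are not completed by
  time \<open>n\<close>.\<close>

lemma miss_bound: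
  assumes V: "cylinder_union q {y. s \<le> y \<and> y < t}" and t: "0 \<le> s" "s \<le> t" "t \<le> 1" and n: "0 < n"
  shows "measure unit_lebesgue {x \<in> regular. \<forall>j<n. \<not> (s \<le> (f ^^ j) x \<and> (f ^^ j) x < t)}
    \<le> (1 - density_lower * (t - s)) ^ M + density_upper * real (M * Suc q) / real n * (\<Sum>k<n. grid k)"
proof -
  let ?S = "{x \<in> regular. \<forall>j<M. \<not> (s \<le> (induced ^^ Suc (j * Suc q)) x \<and> (induced ^^ Suc (j * Suc q)) x < t)}"
  let ?T = "{x \<in> regular. n \<le> elapsed (M * Suc q) x}"
  have surv: "concave_pushforward (M * Suc q) ?S" "measure unit_lebesgue ?S \<le> (1 - density_lower * (t - s)) ^ M"
    using survival_bound[OF V t, of M] by blast+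
  have sets_S: "?S \<in> sets unit_lebesgue" using surv(1) unfolding concave_pushforward_def by (rule conjunct1)
  have sets_T: "?T \<in> sets unit_lebesgue"
  proof -
    have "(\<lambda>x. real (Suc (depth ((induced ^^ i) x)))) \<in> borel_measurable unit_lebesgue" for i
      by (rule measurable_compose[OF measurable_compose[OF induced_iter_measurable depth_measurable]]) simp
    then have "(\<lambda>x. \<Sum>i<M * Suc q. real (Suc (depth ((induced ^^ i) x)))) \<in> borel_measurable unit_lebesgue"
      by (rule borel_measurable_sum)
    then have "{x \<in> space unit_lebesgue. real n \<le> (\<Sum>i<M * Suc q. real (Suc (depth ((induced ^^ i) x))))}
        \<in> sets unit_lebesgue"
      by (rule borel_measurable_le[OF borel_measurable_const])
    moreover have "real n \<le> (\<Sum>i<M * Suc q. real (Suc (depth ((induced ^^ i) x)))) \<longleftrightarrow> n \<le> elapsed (M * Suc q) x" for x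
      unfolding elapsed_def of_nat_sum[symmetric] of_nat_le_iff ..
    ultimately have "{x \<in> space unit_lebesgue. n \<le> elapsed (M * Suc q) x} \<in> sets unit_lebesgue"
      by (simp only:)
    from sets.Int[OF sets_regular this] show ?thesis
      by (rule back_subst[of "\<lambda>A. A \<in> sets unit_lebesgue"]) (auto simp: regular_def)
  qed
  have "measure unit_lebesgue {x \<in> regular. \<forall>j<n. \<not> (s \<le> (f ^^ j) x \<and> (f ^^ j) x < t)}
      \<le> measure unit_lebesgue (?S \<union> ?T)"
  proof (rule U.finite_measure_mono)
    show "?S \<union> ?T \<in> sets unit_lebesgue" by (rule sets.Un[OF sets_S sets_T])
    show "{x \<in> regular. \<forall>j<n. \<not> (s \<le> (f ^^ j) x \<and> (f ^^ j) x < t)} \<subseteq> ?S \<union> ?T"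
    proof
      fix x assume x: "x \<in> {x \<in> regular. \<forall>j<n. \<not> (s \<le> (f ^^ j) x \<and> (f ^^ j) x < t)}"
      have "\<not> (s \<le> (induced ^^ Suc (j * Suc q)) x \<and> (induced ^^ Suc (j * Suc q)) x < t)"
        if "x \<notin> ?T" "j < M" for j
      proof -
        have "Suc j * Suc q \<le> M * Suc q" using that by (intro mult_le_mono1) auto
        then have "Suc (j * Suc q) \<le> M * Suc q" by simp
        then have "elapsed (Suc (j * Suc q)) x \<le> elapsed (M * Suc q) x"
          unfolding elapsed_def by (intro sum_mono2) auto
        also have "\<dots> < n" using that(1) x by auto
        finally show ?thesis using x unfolding induced_iter_eq by blast
      qed
      then show "x \<in> ?S \<union> ?T" using x by blast
    qed
  qed
  also have "\<dots> \<le> measure unit_lebesgue ?S + measure unit_lebesgue ?T"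
    by (rule measure_Un_le[OF sets_S sets_T])
  also have "\<dots> \<le> (1 - density_lower * (t - s)) ^ M + density_upper * real (M * Suc q) / real n * (\<Sum>k<n. grid k)"
    by (intro add_mono surv(2) elapsed_bound n)
  finally show ?thesis .
qed

lemma sum_grid: "(\<Sum>k<2^m. grid k) \<le> real (Suc m) * 2 powr (real m * (1 - 1 / \<alpha>))"
proof (induction m)
  case (Suc m)
  define b where "b = 1 - 1 / \<alpha>"
  have b: "0 \<le> b" using alpha by (simp add: b_def)
  have "(\<Sum>k<2^Suc m. grid k) = (\<Sum>k<2^m. grid k) + (\<Sum>k\<in>{2^m..<2^Suc m}. grid k)"
    by (subst sum.union_disjoint[symmetric]) (auto intro!: sum.cong)
  also have "(\<Sum>k\<in>{2^m..<2^Suc m}. grid k) \<le> (\<Sum>k\<in>{2^m..<2^Suc m::nat}. grid (2^m))"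
    by (intro sum_mono grid_mono) auto
  also have "\<dots> = 2^m * grid (2^m)" by simp
  also have "\<dots> \<le> 2^m * real (2^m) powr (- (1 / \<alpha>))" by (intro mult_left_mono grid_upper) auto
  also have "\<dots> = 2 powr (real m * b)"
    by (simp add: b_def powr_powr right_diff_distrib powr_diff powr_minus divide_inverse flip: powr_realpow)
  finally have "(\<Sum>k<2^Suc m. grid k) \<le> real (Suc m) * 2 powr (real m * b) + 2 powr (real m * b)"
    using Suc by (simp add: b_def)
  also have "\<dots> = real (Suc (Suc m)) * 2 powr (real m * b)" by (simp add: algebra_simps)
  also have "\<dots> \<le> real (Suc (Suc m)) * 2 powr (real (Suc m) * b)"
    using b by (intro mult_left_mono powr_mono mult_right_mono) auto
  finally show ?case by (simp add: b_def)
qed simp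

section \<open>Targets made of cylinders\<close>

lemma g_diff_le: "0 \<le> x \<Longrightarrow> x \<le> y \<Longrightarrow> g y - g x \<le> y - x"
proof -
  assume xy: "0 \<le> x" "x \<le> y"
  then have "g x \<le> g y" by (simp add: g_le_iff)
  then have "g x powr (1 + \<alpha>) \<le> g y powr (1 + \<alpha>)"
    using alpha g_nonneg[of x] xy by (intro powr_mono2) auto
  then have "2 powr \<alpha> * g x powr (1 + \<alpha>) \<le> 2 powr \<alpha> * g y powr (1 + \<alpha>)" by simp
  moreover have "x = g x + 2 powr \<alpha> * g x powr (1 + \<alpha>)" "y = g y + 2 powr \<alpha> * g y powr (1 + \<alpha>)"
    using left_branch_g[of x] left_branch_g[of y] g_nonneg[of x] g_nonneg[of y] xy
    by (simp_all add: left_branch_eq)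
  ultimately show ?thesis by linarith
qed

lemma branch_diff_le: "0 \<le> x \<Longrightarrow> x \<le> y \<Longrightarrow> branch k y - branch k x \<le> (y - x) / 2"
proof -
  assume xy: "0 \<le> x" "x \<le> y"
  have "0 \<le> a \<Longrightarrow> a \<le> b \<Longrightarrow> (g ^^ k) b - (g ^^ k) a \<le> b - a" for a b
  proof (induction k)
    case (Suc k)
    have "g ((g ^^ k) b) - g ((g ^^ k) a) \<le> (g ^^ k) b - (g ^^ k) a"
      using Suc.prems by (intro g_diff_le) (auto simp: g_iter_nonneg g_iter_le_iff)
    then show ?case using Suc by simp
  qed simp
  from this[of "(1 + x) / 2" "(1 + y) / 2"] show ?thesis
    using xy by (simp add: branch_def diff_divide_distrib add_divide_distrib)
qed

lemma branch_induced:
  assumes "grid (Suc k) \<le> y" "y < grid k"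
  shows "branch k (induced y) = y"
proof -
  have y: "0 \<le> y" "y < 1" using assms grid_pos[of "Suc k"] grid_le_1[of k] by auto
  have H0: "0 \<le> induced y" using induced_range[of y] y by simp
  have "\<not> y < branch k (induced y)" using induced_less_iff[OF assms H0] by simp
  moreover have "\<not> branch k (induced y) < y"
  proof
    assume less: "branch k (induced y) < y"
    define z where "z = (f ^^ k) y"
    have "(g ^^ k) z = y" "0 \<le> z" using excursion[OF y(1) assms(2), of k] by (auto simp: z_def)
    then have "(1 + induced y) / 2 < z"
      using less H0 g_iter_less_iff[of "(1 + induced y) / 2" z k] by (simp add: branch_def)
    moreover have "induced y = f z" using depth_eq[OF assms] by (simp add: induced_def z_def)
    ultimately show False using \<open>0 \<le> z\<close> H0 by (cases "1/2 \<le> z") (auto simp: f_right)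
  qed
  ultimately show ?thesis by simp
qed

lemma cylinder_union_empty: "cylinder_union q {}"
  using cylinder_union_Compl[OF cylinder_union_UNIV] by simp

text \<open>Every point is approximated from the left, up to \<open>(1/2) ^ q\<close>, by a point that is not interior to any
  cylinder of order \<open>q\<close>. This is so because all inverse branches contract by the factor 2.\<close>

lemma cylinder_union_below:
  assumes "0 \<le> t" "t \<le> 1"
  shows "\<exists>t'. 0 \<le> t' \<and> t' \<le> t \<and> t - t' \<le> (1/2) ^ q \<and> cylinder_union q {y. y < t'}"
  using assms
proof (induction q arbitrary: t)
  case 0
  then show ?case by (intro exI[of _ 0]) auto
next
  case (Suc q)
  consider "t = 0" | "t = 1" | "0 < t" "t < 1" using Suc.prems by linarith
  then show ?case
  proof cases
    case 1
    have "cylinder_union (Suc q) {y. y < 0}" unfolding cylinder_union.simps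
      using grid_pos by (intro allI exI[of _ "{}"]) (auto simp: cylinder_union_empty not_less intro: order_trans[OF less_imp_le])
    then show ?thesis using 1 by (intro exI[of _ 0]) auto
  next
    case 2
    have "cylinder_union (Suc q) {y. y < 1}" unfolding cylinder_union.simps
      using grid_le_1 by (intro allI exI[of _ "UNIV"]) (auto simp: cylinder_union_UNIV intro: less_le_trans)
    then show ?thesis using 2 by (intro exI[of _ 1]) auto
  next
    case 3
    define k where "k = depth t"
    have k: "grid (Suc k) \<le> t" "t < grid k" using depth_bounds[OF 3] by (auto simp: k_def)
    have Ht: "0 \<le> induced t" "induced t \<le> 1" using induced_range[of t] 3 by auto
    obtain y' where y': "0 \<le> y'" "y' \<le> induced t" "induced t - y' \<le> (1/2) ^ q" "cylinder_union q {y. y < y'}"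
      using Suc.IH[OF Ht] by blast
    define t' where "t' = branch k y'"
    have t': "grid (Suc k) \<le> t'" "t' \<le> t" "t \<le> grid k"
      using y' branch_mono[of 0 y' k] branch_mono[of y' "induced t" k] branch_induced[OF k] k
      by (auto simp: t'_def branch_0)
    have "t - t' \<le> (induced t - y') / 2"
      using branch_diff_le[OF y'(1,2), of k] branch_induced[OF k] by (simp add: t'_def)
    then have "t - t' \<le> (1/2) ^ Suc q" using y'(3) by simp
    moreover have "cylinder_union (Suc q) {y. y < t'}" unfolding cylinder_union.simps
    proof
      fix i
      consider "i < k" | "i = k" | "k < i" by linarith
      then show "\<exists>W. cylinder_union q W \<and> (\<forall>y. grid (Suc i) \<le> y \<and> y < grid i \<longrightarrow> (y \<in> {y. y < t'} \<longleftrightarrow> induced y \<in> W))"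
      proof cases
        case 1
        then have "t' \<le> grid (Suc i)" using t' grid_mono[of "Suc i" k] by simp
        then show ?thesis by (intro exI[of _ "{}"]) (auto simp: cylinder_union_empty)
      next
        case 2
        then show ?thesis using y'(1,4) induced_less_iff[of k _ y'] by (intro exI[of _ "{y. y < y'}"]) (auto simp: t'_def)
      next
        case 3
        then have "grid i \<le> t'" using t' grid_mono[of "Suc k" i] by simp
        then show ?thesis by (intro exI[of _ UNIV]) (auto simp: cylinder_union_UNIV)
      qed
    qed
    ultimately show ?thesis using t' grid_pos[of "Suc k"] by (intro exI[of _ t']) auto
  qed
qed

lemma cylinder_union_grid: "cylinder_union (Suc 0) {y. y < grid k}"
  unfolding cylinder_union.simps(2)
proof
  fix i
  show "\<exists>W. cylinder_union 0 W \<and> (\<forall>y. grid (Suc i) \<le> y \<and> y < grid i \<longrightarrow> (y \<in> {y. y < grid k} \<longleftrightarrow> induced y \<in> W))"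
  proof (cases "k \<le> i")
    case True
    then show ?thesis using grid_mono[of k i] by (intro exI[of _ UNIV]) (auto)
  next
    case False
    then show ?thesis using grid_mono[of "Suc i" k] by (intro exI[of _ "{}"]) (auto)
  qed
qed

lemma cylinder_union_interval:
  "cylinder_union q {y. y < s} \<Longrightarrow> cylinder_union q {y. y < t} \<Longrightarrow>
    cylinder_union q {y. s \<le> y \<and> y < t}"
  using cylinder_union_Int[OF cylinder_union_Compl[of q "{y. y < s}"], of "{y. y < t}"] 
  by (simp add: Collect_neg_eq[symmetric] Collect_conj_eq[symmetric] not_less)

section \<open>The upper bound on the distance\<close>

text \<open>Test the target in about \<open>M = 2 powr (m/\<alpha>) / m powr (2 + \<kappa> + e)\<close> blocks of length at most
  \<open>2 * m powr \<kappa>\<close>. Then \<open>M\<close> times the length of the target is at least of order \<open>m powr e\<close>, so the survival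
  probability is at most \<open>exp (- c * m powr e)\<close>, while the probability that the tests take more than
  \<open>2 ^ m\<close> steps is of order \<open>m powr (-1 - e)\<close>. Both are summable.\<close>

lemma AE_shrinking_targets:
  fixes q :: "nat \<Rightarrow> nat" and s t :: "nat \<Rightarrow> real"
  assumes e: "0 < e"
    and q: "\<forall>\<^sub>F m in sequentially. real (Suc (q m)) \<le> 2 * real m powr \<kappa>"
    and st: "\<forall>\<^sub>F m in sequentially. 0 \<le> s m \<and> s m \<le> t m \<and> t m \<le> 1"
    and cylinder_union: "\<forall>\<^sub>F m in sequentially. cylinder_union (q m) {y. s m \<le> y \<and> y < t m}"
    and len: "\<forall>\<^sub>F m in sequentially.
      real m powr (2 + \<kappa> + 2 * e) / 2 powr (real m / \<alpha>) / 2 \<le> t m - s m"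
  shows "AE x in unit_lebesgue. \<forall>\<^sub>F m in sequentially. \<exists>j<2^m. s m \<le> (f ^^ j) x \<and> (f ^^ j) x < t m"
proof -
  define A where "A m = {x \<in> regular. \<forall>j<2^m. \<not> (s m \<le> (f ^^ j) x \<and> (f ^^ j) x < t m)}" for m
  define X where "X m = 2 powr (real m / \<alpha>) / real m powr (2 + \<kappa> + e)" for m
  define B where "B m = exp (- (density_lower / 2 * real m powr e)) + 8 * density_upper * real m powr (- 1 - e)" for m
  have "AE x in unit_lebesgue. \<forall>\<^sub>F m in sequentially. x \<notin> A m"
  proof (rule eventually_not_in_AE)
    fix m
    have "A m = regular - (\<Union>j<2^m. {x \<in> space unit_lebesgue. s m \<le> (f ^^ j) x \<and> (f ^^ j) x < t m})"
      unfolding A_def by (auto simp: regular_def)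
    also have "\<dots> \<in> sets unit_lebesgue"
      by (intro sets.Diff sets_regular sets.finite_UN sets_f_iter_between) auto
    finally show "A m \<in> sets unit_lebesgue" .
  next
    have "(\<lambda>m. exp (- (density_lower / 2 * real m powr e))) \<in> O(\<lambda>m. 1 / real m ^ 2)"
      using density_lower_pos e by real_asymp
    moreover have "summable (\<lambda>m. norm (1 / real m ^ 2))"
      using inverse_power_summable[of 2] by (simp add: field_simps)
    ultimately have "summable (\<lambda>m. exp (- (density_lower / 2 * real m powr e)))"
      by (rule summable_comparison_test_bigo[rotated])
    moreover have "summable (\<lambda>m. real m powr (- 1 - e))"
      using e by (subst summable_real_powr_iff) simp
    ultimately show "summable B" unfolding B_def by (intro summable_add summable_mult)
  next
    have "\<forall>\<^sub>F m in sequentially. 1 \<le> X m" unfolding X_def using alpha by real_asymp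
    then show "\<forall>\<^sub>F m in sequentially. measure unit_lebesgue (A m) \<le> B m"
      using q st cylinder_union len eventually_gt_at_top[of 0]
    proof eventually_elim
      case (elim m)
      define M where "M = nat \<lceil>X m\<rceil>"
      have M: "X m \<le> real M" "real M \<le> 2 * X m"
        using elim(1) unfolding M_def by linarith+
      have m: "1 \<le> real m" using elim by simp
      have "measure unit_lebesgue (A m)
          \<le> (1 - density_lower * (t m - s m)) ^ M + density_upper * real (M * Suc (q m)) / real (2^m) * (\<Sum>k<2^m. grid k)"
        unfolding A_def using elim by (intro miss_bound) auto
      also have "(1 - density_lower * (t m - s m)) ^ M \<le> exp (- (density_lower / 2 * real m powr e))"
      proof -
        have "density_lower * (t m - s m) \<le> 1 * 1" using elim density_lower_pos density_lower_le_1 by (intro mult_mono) auto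
        then have "(1 - density_lower * (t m - s m)) ^ M \<le> exp (- (density_lower * (t m - s m))) ^ M"
          using exp_ge_add_one_self[of "- (density_lower * (t m - s m))"] by (intro power_mono) auto
        also have "\<dots> = exp (- (density_lower * (t m - s m) * real M))" by (simp add: mult.commute flip: exp_of_nat_mult)
        also have "\<dots> \<le> exp (- (density_lower / 2 * real m powr e))"
        proof -
          have "real m powr (2 + \<kappa> + 2 * e) = real m powr (2 + \<kappa> + e) * real m powr e"
            by (simp flip: powr_add add: algebra_simps)
          then have "density_lower / 2 * real m powr e
              = density_lower * (real m powr (2 + \<kappa> + 2 * e) / 2 powr (real m / \<alpha>) / 2) * X m"
            using m by (simp add: X_def)
          also have "\<dots> \<le> density_lower * (t m - s m) * real M"
            using elim M density_lower_pos by (intro mult_mono mult_left_mono) auto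
          finally show ?thesis by simp
        qed
        finally show ?thesis .
      qed
      also have "density_upper * real (M * Suc (q m)) / real (2^m) * (\<Sum>k<2^m. grid k) \<le> 8 * density_upper * real m powr (- 1 - e)"
      proof -
        define P where "P = 2 powr (real m * (1 - 1 / \<alpha>))"
        have "real (M * Suc (q m)) \<le> (2 * X m) * (2 * real m powr \<kappa>)"
          unfolding of_nat_mult using elim M by (intro mult_mono) auto
        moreover have "(\<Sum>k<2^m. grid k) \<le> (2 * real m) * P"
          unfolding P_def using m by (intro order_trans[OF sum_grid] mult_right_mono) auto
        moreover have "0 \<le> (\<Sum>k<2^m. grid k)" by (intro sum_nonneg less_imp_le[OF grid_pos])
        ultimately have "density_upper * real (M * Suc (q m)) / real (2^m) * (\<Sum>k<2^m. grid k)
            \<le> density_upper * ((2 * X m) * (2 * real m powr \<kappa>)) / real (2^m) * ((2 * real m) * P)"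
          using density_upper_ge_1 elim by (intro mult_mono divide_right_mono mult_left_mono) auto
        also have "\<dots> = 8 * density_upper * (real m powr \<kappa> * real m / real m powr (2 + \<kappa> + e))
            * (2 powr (real m / \<alpha>) * P / real (2^m))" by (simp add: X_def)
        also have "2 powr (real m / \<alpha>) * P = real (2^m)"
          by (simp add: P_def right_diff_distrib powr_diff powr_realpow)
        also have "real m powr \<kappa> * real m / real m powr (2 + \<kappa> + e) = real m powr (- 1 - e)"
        proof -
          have "real m powr \<kappa> * real m = real m powr (\<kappa> + 1)" using m by (simp add: powr_add)
          moreover have "\<kappa> + 1 - (2 + \<kappa> + e) = - 1 - e" by simp
          ultimately show ?thesis by (metis powr_diff)
        qed
        finally show ?thesis by simp
      qed
      finally show ?case by (simp add: B_def)
    qed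
  qed
  with AE_regular show ?thesis
  proof eventually_elim
    case (elim x)
    from elim(2) show ?case by eventually_elim (use elim(1) in \<open>auto simp: A_def\<close>)
  qed
qed

text \<open>The intervals \<open>{0..<grid k}\<close> are unions of cylinders of order 1, and consecutive points of the grid
  differ at most by the factor 2.\<close>

lemma AE_distance_upper_0:
  assumes e: "0 < e"
  shows "AE x in unit_lebesgue. \<forall>\<^sub>F m in sequentially. \<exists>j<2^m.
     dist ((f ^^ j) x) 0 \<le> real m powr (2 + 2 * e) / 2 powr (real m / \<alpha>)"
proof -
  define r where "r m = real m powr (2 + 2 * e) / 2 powr (real m / \<alpha>)" for m
  define t where "t m = grid (Suc (depth (r m)))" for m
  have "\<forall>\<^sub>F m in sequentially. r m < 1" "\<forall>\<^sub>F m in sequentially. 0 < r m"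
    unfolding r_def using alpha by real_asymp+
  then have t: "\<forall>\<^sub>F m in sequentially. t m \<le> r m \<and> r m \<le> 2 * t m"
  proof eventually_elim
    case (elim m)
    define k where "k = depth (r m)"
    have k: "grid (Suc k) \<le> r m" "r m < grid k" using depth_bounds elim by (auto simp: k_def)
    let ?y = "grid (Suc k)"
    have y: "0 < ?y" "?y \<le> 1/2" using grid_pos[of "Suc k"] grid_mono[of 1 "Suc k"] by (auto simp: grid_1)
    have "grid k = ?y * (1 + 2 powr \<alpha> * ?y powr \<alpha>)"
      using left_branch_g[of "grid k"] grid_pos[of k] by (simp add: grid_Suc left_branch_def)
    also have "2 powr \<alpha> * ?y powr \<alpha> = (2 * ?y) powr \<alpha>" using y by (simp add: powr_mult)
    also have "(2 * ?y) powr \<alpha> \<le> 1" using y alpha by (intro powr_le1) auto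
    finally have "grid k \<le> 2 * ?y" using y by (simp add: mult_left_mono)
    then show ?case using k by (simp add: t_def k_def)
  qed
  have "AE x in unit_lebesgue. \<forall>\<^sub>F m in sequentially. \<exists>j<2^m. 0 \<le> (f ^^ j) x \<and> (f ^^ j) x < t m"
  proof (rule AE_shrinking_targets[OF e, where \<kappa> = 0 and q = "\<lambda>_. Suc 0"])
    show "\<forall>\<^sub>F m in sequentially. real (Suc (Suc 0)) \<le> 2 * real m powr 0"
      using eventually_gt_at_top[of 0] by eventually_elim simp
    have "0 \<le> t m \<and> t m \<le> 1" for m
      unfolding t_def using grid_pos[of "Suc (depth (r m))"] grid_le_1 by simp
    then show "\<forall>\<^sub>F m in sequentially. 0 \<le> (0::real) \<and> 0 \<le> t m \<and> t m \<le> 1" by simp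
    obtain z where z: "z \<le> 0" "0 \<le> z" "cylinder_union (Suc 0) {y. y < z}"
      using cylinder_union_below[of 0 "Suc 0"] by auto
    then show "\<forall>\<^sub>F m in sequentially. cylinder_union (Suc 0) {y. 0 \<le> y \<and> y < t m}"
      using cylinder_union_interval[of "Suc 0" 0] cylinder_union_grid unfolding t_def by (auto intro!: always_eventually)
    show "\<forall>\<^sub>F m in sequentially. real m powr (2 + 0 + 2 * e) / 2 powr (real m / \<alpha>) / 2 \<le> t m - 0"
      using t by eventually_elim (simp add: r_def)
  qed
  then show ?thesis
  proof eventually_elim
    case (elim x)
    from elim t show ?case
    proof eventually_elim
      case (elim m)
      then obtain j where j: "j < 2^m" "0 \<le> (f ^^ j) x" "(f ^^ j) x < t m" by blast
      then have "dist ((f ^^ j) x) 0 \<le> r m" using elim(2) by (simp add: dist_real_def)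
      then show ?case using j(1) by (auto simp: r_def)
    qed
  qed
qed

text \<open>Cylinders of order \<open>m\<close> are no longer than \<open>(1/2) ^ m\<close>, which is small compared with the radius, so most of
  the interval of that radius to the left of \<open>p\<close> is a union of such cylinders. The order \<open>m\<close> is the
  reason for one more factor \<open>m\<close> than at \<open>p = 0\<close>.\<close>

lemma AE_distance_upper_pos:
  assumes e: "0 < e" and p: "0 < p" "p \<le> 1"
  shows "AE x in unit_lebesgue. \<forall>\<^sub>F m in sequentially. \<exists>j<2^m.
     dist ((f ^^ j) x) p \<le> real m powr (3 + 2 * e) / 2 powr (real m / \<alpha>)"
proof -
  define r where "r m = real m powr (3 + 2 * e) / 2 powr (real m / \<alpha>)" for m
  have small: "\<forall>\<^sub>F m in sequentially. r m < p"
    unfolding r_def using alpha p by real_asymp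
  have fine: "\<forall>\<^sub>F m in sequentially. (1/2) ^ m \<le> r m / 4"
  proof -
    have "\<forall>\<^sub>F m in sequentially. 4 \<le> real m powr (3 + 2 * e)" using e by real_asymp
    then show ?thesis
    proof eventually_elim
      case (elim m)
      have "2 powr (real m / \<alpha>) \<le> 2 powr real m"
        using alpha by (intro powr_mono) (auto simp: divide_le_eq mult_le_cancel_left1)
      then have "4 / 2 ^ m \<le> real m powr (3 + 2 * e) / 2 powr (real m / \<alpha>)"
        using elim by (intro frac_le) (auto simp: powr_realpow)
      then show ?case by (simp add: r_def power_divide)
    qed
  qed
  define below where "below m u = (SOME u'. 0 \<le> u' \<and> u' \<le> u \<and> u - u' \<le> (1/2) ^ m \<and> cylinder_union m {y. y < u'})" for m u
  have below: "below m u \<le> u" "u - below m u \<le> (1/2) ^ m" "cylinder_union m {y. y < below m u}"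
    if "0 \<le> u" "u \<le> 1" for m u
    using someI_ex[OF cylinder_union_below[OF that, of m]] unfolding below_def by blast+
  define a where "a m = below m (p - r m + (1/2) ^ m)" for m
  define b where "b m = below m p" for m
  have ev: "\<forall>\<^sub>F m in sequentially. 0 \<le> p - r m \<and> p - r m \<le> a m \<and> a m \<le> b m \<and> b m \<le> p
      \<and> r m / 2 \<le> b m - a m \<and> cylinder_union m {y. a m \<le> y \<and> y < b m}"
    using small fine
  proof eventually_elim
    case (elim m)
    have half: "0 < (1/2::real) ^ m" by simp
    \<comment> \<open>shifted to the right, so that its approximation from the left is still at least \<open>p - r m\<close>\<close>
    define c where "c = p - r m + (1/2) ^ m"
    have c: "0 \<le> c" "c \<le> 1" using elim half p unfolding c_def by linarith+
    have b: "b m \<le> p" "p - b m \<le> (1/2) ^ m" "cylinder_union m {y. y < b m}"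
      unfolding b_def using below[of p m] p by auto
    have a: "a m \<le> c" "c - a m \<le> (1/2) ^ m" "cylinder_union m {y. y < a m}"
      unfolding a_def c_def[symmetric] by (rule below[OF c])+
    have "0 \<le> p - r m" "p - r m \<le> a m" "a m \<le> b m" "r m / 2 \<le> b m - a m"
      using a(1,2) b(1,2) elim half unfolding c_def by linarith+
    then show ?case using cylinder_union_interval[OF a(3) b(3)] b(1) by blast
  qed
  have "AE x in unit_lebesgue. \<forall>\<^sub>F m in sequentially. \<exists>j<2^m. a m \<le> (f ^^ j) x \<and> (f ^^ j) x < b m"
  proof (rule AE_shrinking_targets[OF e, where \<kappa> = 1 and q = "\<lambda>m. m"])
    show "\<forall>\<^sub>F m in sequentially. real (Suc m) \<le> 2 * real m powr 1"
      using eventually_gt_at_top[of 0] by eventually_elim simp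
    show "\<forall>\<^sub>F m in sequentially. 0 \<le> a m \<and> a m \<le> b m \<and> b m \<le> 1"
      using ev by eventually_elim (use p in auto)
    show "\<forall>\<^sub>F m in sequentially. cylinder_union m {y. a m \<le> y \<and> y < b m}"
      using ev by eventually_elim simp
    show "\<forall>\<^sub>F m in sequentially. real m powr (2 + 1 + 2 * e) / 2 powr (real m / \<alpha>) / 2 \<le> b m - a m"
      using ev by eventually_elim (simp add: r_def)
  qed
  then show ?thesis
  proof eventually_elim
    case (elim x)
    from elim ev show ?case
    proof eventually_elim
      case (elim m)
      then obtain j where j: "j < 2^m" "a m \<le> (f ^^ j) x" "(f ^^ j) x < b m" by blast
      then have "dist ((f ^^ j) x) p \<le> r m" using elim(2) by (simp add: dist_real_def abs_le_iff)
      then show ?case using j(1) by (auto simp: r_def)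
    qed
  qed
qed

end

section \<open>From powers of two to all times\<close>

text \<open>The distance is monotone in \<open>n\<close>, so a statement about the two neighbouring powers of 2 decides
  about \<open>n\<close>; the constants lost on the way are absorbed by a slightly larger power of the logarithm.\<close>

lemma eventually_between_powers:
  assumes "\<forall>\<^sub>F m in sequentially. P m"
  shows "\<forall>\<^sub>F n in sequentially. \<exists>m. P m \<and> P (Suc m) \<and> 2 ^ m \<le> n \<and> n < 2 ^ Suc m"
proof -
  obtain m0 where m0: "\<And>m. m0 \<le> m \<Longrightarrow> P m" using assms by (auto simp: eventually_sequentially)
  show ?thesis
    using eventually_ge_at_top[of "2 ^ m0"]
  proof eventually_elim
    case (elim n)
    have "1 \<le> n" using elim by (meson one_le_numeral one_le_power order_trans)
    then obtain m where m: "2 ^ m \<le> n" "n < 2 ^ Suc m" using ex_power_ivl1[of 2 n] by auto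
    have "(2::nat) ^ m0 < 2 ^ Suc m" using elim m by linarith
    then have "m0 \<le> m" by (simp add: power_strict_increasing_iff del: power_Suc)
    then show ?case using m0 m by (intro exI[of _ m]) auto
  qed
qed

lemma ln_powr_between_powers:
  fixes K :: real
  assumes n: "2 ^ m \<le> n" "n < 2 ^ Suc m" and "0 \<le> K"
  shows "(real m * ln 2) powr K \<le> ln (real n) powr K"
proof (rule powr_mono2)
  have "real m * ln 2 = ln (2 ^ m :: real)" by (simp add: ln_realpow)
  also have "\<dots> \<le> ln (real n)"
  proof -
    have "real (2 ^ m) \<le> real n" using n(1) of_nat_le_iff by blast
    then show ?thesis by (subst ln_le_cancel_iff) (auto intro: less_le_trans[of _ "2^m"])
  qed
  finally show "real m * ln 2 \<le> ln (real n)" .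
qed (use assms in auto)

lemma max_process_ge:
  assumes psi: "antimono_on {0..} \<psi>" and j: "j < n" and le: "dist ((intermittent_map \<alpha> ^^ j) x) p \<le> r"
  shows "\<psi> r \<le> max_process \<alpha> \<psi> p n x"
proof -
  have "\<psi> r \<le> \<psi> (dist ((intermittent_map \<alpha> ^^ j) x) p)"
    using le by (intro monotone_onD[OF psi]) (auto intro: order_trans[OF zero_le_dist])
  also have "\<dots> \<le> max_process \<alpha> \<psi> p n x"
    unfolding max_process_def using j by (intro Max_ge) auto
  finally show ?thesis .
qed

lemma max_process_le:
  assumes psi: "antimono_on {0..} \<psi>" and "0 < n" "0 \<le> r"
    and ge: "\<And>j. j < n \<Longrightarrow> r \<le> dist ((intermittent_map \<alpha> ^^ j) x) p"
  shows "max_process \<alpha> \<psi> p n x \<le> \<psi> r"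
  unfolding max_process_def
proof (rule Max.boundedI)
  fix v assume "v \<in> (\<lambda>j. \<psi> (dist ((intermittent_map \<alpha> ^^ j) x) p)) ` {0..<n}"
  then obtain j where "j < n" "v = \<psi> (dist ((intermittent_map \<alpha> ^^ j) x) p)" by auto
  then show "v \<le> \<psi> r" using ge[of j] assms(3) by (auto intro!: monotone_onD[OF psi])
qed (use assms in auto)

lemma max_process_ge_eventually:
  fixes \<alpha> K K' :: real
  assumes alpha: "0 < \<alpha>" and psi: "antimono_on {0..} \<psi>" and K: "0 \<le> K'" "K' < K"
    and x: "\<forall>\<^sub>F m in sequentially. \<exists>j<2^m.
      dist ((intermittent_map \<alpha> ^^ j) x) p \<le> real m powr K' / 2 powr (real m / \<alpha>)"
  shows "\<forall>\<^sub>F n in sequentially. \<psi> (ln (real n) powr K / real n powr (1 / \<alpha>)) \<le> max_process \<alpha> \<psi> p n x"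
proof -
  have "\<forall>\<^sub>F m in sequentially. 2 powr (1 / \<alpha>) * real m powr K' \<le> (real m * ln 2) powr K"
    using K alpha by real_asymp
  from eventually_between_powers[OF eventually_conj[OF this x]] show ?thesis
  proof eventually_elim
    case (elim n)
    then obtain m j where m: "2 powr (1 / \<alpha>) * real m powr K' \<le> (real m * ln 2) powr K"
      and n: "2 ^ m \<le> n" "n < 2 ^ Suc m" and j: "j < 2 ^ m"
      "dist ((intermittent_map \<alpha> ^^ j) x) p \<le> real m powr K' / 2 powr (real m / \<alpha>)" by blast
    have n0: "0 < real n" using n(1) by (auto intro: less_le_trans[of _ "2^m"])
    have "real n \<le> 2 * 2 powr real m" using n(2) by (simp add: powr_realpow)
      (metis less_imp_le of_nat_le_iff of_nat_mult of_nat_numeral of_nat_power)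
    then have "real n powr (1 / \<alpha>) \<le> (2 * 2 powr real m) powr (1 / \<alpha>)"
      using alpha by (intro powr_mono2) auto
    also have "\<dots> = 2 powr (1 / \<alpha>) * 2 powr (real m / \<alpha>)" by (simp add: powr_mult powr_powr)
    finally have pow: "real n powr (1 / \<alpha>) \<le> 2 powr (1 / \<alpha>) * 2 powr (real m / \<alpha>)" .
    have "real m powr K' / 2 powr (real m / \<alpha>)
        = 2 powr (1 / \<alpha>) * real m powr K' / (2 powr (1 / \<alpha>) * 2 powr (real m / \<alpha>))" by simp
    also have "\<dots> \<le> ln (real n) powr K / real n powr (1 / \<alpha>)"
      using m ln_powr_between_powers[OF n, of K] K n0 pow by (intro frac_le) auto
    finally show ?case using j n(1) by (intro max_process_ge[OF psi, of j]) auto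
  qed
qed

lemma max_process_le_eventually:
  fixes \<alpha> K :: real
  assumes alpha: "0 < \<alpha>" and psi: "antimono_on {0..} \<psi>" and K: "2 < K"
    and x: "\<forall>\<^sub>F m in sequentially. \<forall>j<2^m.
      1 / (real m ^ 2 * 2 powr (real m / \<alpha>)) \<le> dist ((intermittent_map \<alpha> ^^ j) x) p"
  shows "\<forall>\<^sub>F n in sequentially. max_process \<alpha> \<psi> p n x \<le> \<psi> (1 / (real n powr (1 / \<alpha>) * ln (real n) powr K))"
proof -
  have "\<forall>\<^sub>F m in sequentially. 2 powr (1 / \<alpha>) * real (Suc m) ^ 2 \<le> (real m * ln 2) powr K"
    using K alpha by real_asymp
  from eventually_between_powers[OF eventually_conj[OF this x]] show ?thesis
  proof eventually_elim
    case (elim n)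
    then obtain m where m: "2 powr (1 / \<alpha>) * real (Suc m) ^ 2 \<le> (real m * ln 2) powr K"
      and n: "2 ^ m \<le> n" "n < 2 ^ Suc m" and far: "\<And>j. j < 2 ^ Suc m \<Longrightarrow>
        1 / (real (Suc m) ^ 2 * 2 powr (real (Suc m) / \<alpha>)) \<le> dist ((intermittent_map \<alpha> ^^ j) x) p" by blast
    have n0: "0 < n" using less_le_trans[OF _ n(1)] by simp
    have "real (2 ^ m) powr (1 / \<alpha>) \<le> real n powr (1 / \<alpha>)"
      using n(1) alpha by (intro powr_mono2) (auto simp del: of_nat_power)
    then have pow: "2 powr (real m / \<alpha>) \<le> real n powr (1 / \<alpha>)"
      by (simp add: powr_powr flip: powr_realpow)
    have "2 powr (real (Suc m) / \<alpha>) = 2 powr (real m / \<alpha>) * 2 powr (1 / \<alpha>)"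
      by (simp add: add_divide_distrib add.commute flip: powr_add)
    then have "real (Suc m) ^ 2 * 2 powr (real (Suc m) / \<alpha>)
        = 2 powr (real m / \<alpha>) * (2 powr (1 / \<alpha>) * real (Suc m) ^ 2)" by simp
    also have "\<dots> \<le> real n powr (1 / \<alpha>) * ln (real n) powr K"
      using m ln_powr_between_powers[OF n, of K] K pow by (intro mult_mono) auto
    finally have "1 / (real n powr (1 / \<alpha>) * ln (real n) powr K)
        \<le> 1 / (real (Suc m) ^ 2 * 2 powr (real (Suc m) / \<alpha>))"
      by (intro frac_le) auto
    then show ?case using n far n0 by (intro max_process_le[OF psi]) (auto intro: order_trans)
  qed
qed

theorem theorem2p22:
  fixes \<alpha> :: real and \<psi> :: "real \<Rightarrow> real" and p :: real
  assumes "\<alpha> \<ge> 1"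
    and "antimono_on {0..} \<psi>"
    and "p \<in> {0..1}"
  shows "\<forall>\<epsilon>>0. AE x in lebesgue_on {0..<1}.
    (p = 0 \<longrightarrow> (\<forall>\<^sub>F n in sequentially.
        \<psi> (ln (real n) powr (2 + \<epsilon>) / real n powr (1 / \<alpha>)) \<le> max_process \<alpha> \<psi> p n x \<and>
        max_process \<alpha> \<psi> p n x \<le> \<psi> (1 / (real n powr (1 / \<alpha>) * ln (real n) powr (2 + \<epsilon>))))) \<and>
    (p \<in> {0<..1} \<longrightarrow> (\<forall>\<^sub>F n in sequentially.
        \<psi> (ln (real n) powr (4 + \<epsilon>) / real n powr (1 / \<alpha>)) \<le> max_process \<alpha> \<psi> p n x \<and>
        max_process \<alpha> \<psi> p n x \<le> \<psi> (1 / (real n powr (1 / \<alpha>) * ln (real n) powr (2 + \<epsilon>)))))"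
proof (intro allI impI)
  fix \<epsilon> :: real assume eps: "0 < \<epsilon>"
  interpret intermittent \<alpha> using assms(1) by unfold_locales
  have alpha0: "0 < \<alpha>" using assms(1) by simp
  define e where "e = \<epsilon> / 4"
  have e: "0 < e" using eps by (simp add: e_def)
  have p: "0 \<le> p" "p \<le> 1" using assms(3) by auto
  have upper: "AE x in unit_lebesgue. \<forall>\<^sub>F n in sequentially.
      max_process \<alpha> \<psi> p n x \<le> \<psi> (1 / (real n powr (1 / \<alpha>) * ln (real n) powr (2 + \<epsilon>)))"
    using AE_distance_lower[OF p]
    by eventually_elim (rule max_process_le_eventually[OF alpha0 assms(2)], use eps in auto)
  have near_0: "AE x in unit_lebesgue. p = 0 \<longrightarrow> (\<forall>\<^sub>F n in sequentially.
      \<psi> (ln (real n) powr (2 + \<epsilon>) / real n powr (1 / \<alpha>)) \<le> max_process \<alpha> \<psi> p n x)"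
    using AE_distance_upper_0[OF e]
    by eventually_elim
      (intro impI max_process_ge_eventually[OF alpha0 assms(2), of "2 + 2 * e"], use e eps in \<open>auto simp: e_def\<close>)
  have near_pos: "AE x in unit_lebesgue. \<forall>\<^sub>F n in sequentially.
      \<psi> (ln (real n) powr (4 + \<epsilon>) / real n powr (1 / \<alpha>)) \<le> max_process \<alpha> \<psi> p n x" if "0 < p"
    using AE_distance_upper_pos[OF e that p(2)]
    by eventually_elim
      (rule max_process_ge_eventually[OF alpha0 assms(2), of "3 + 2 * e"], use e eps in \<open>auto simp: e_def\<close>)
  then have near_pos: "AE x in unit_lebesgue. 0 < p \<longrightarrow> (\<forall>\<^sub>F n in sequentially.
      \<psi> (ln (real n) powr (4 + \<epsilon>) / real n powr (1 / \<alpha>)) \<le> max_process \<alpha> \<psi> p n x)"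
    by (cases "0 < p") auto
  show "AE x in lebesgue_on {0..<1}.
    (p = 0 \<longrightarrow> (\<forall>\<^sub>F n in sequentially.
        \<psi> (ln (real n) powr (2 + \<epsilon>) / real n powr (1 / \<alpha>)) \<le> max_process \<alpha> \<psi> p n x \<and>
        max_process \<alpha> \<psi> p n x \<le> \<psi> (1 / (real n powr (1 / \<alpha>) * ln (real n) powr (2 + \<epsilon>))))) \<and>
    (p \<in> {0<..1} \<longrightarrow> (\<forall>\<^sub>F n in sequentially.
        \<psi> (ln (real n) powr (4 + \<epsilon>) / real n powr (1 / \<alpha>)) \<le> max_process \<alpha> \<psi> p n x \<and>
        max_process \<alpha> \<psi> p n x \<le> \<psi> (1 / (real n powr (1 / \<alpha>) * ln (real n) powr (2 + \<epsilon>)))))"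
  proof (rule AE_lebesgue_on_unit)
    show "AE x in unit_lebesgue.
    (p = 0 \<longrightarrow> (\<forall>\<^sub>F n in sequentially.
        \<psi> (ln (real n) powr (2 + \<epsilon>) / real n powr (1 / \<alpha>)) \<le> max_process \<alpha> \<psi> p n x \<and>
        max_process \<alpha> \<psi> p n x \<le> \<psi> (1 / (real n powr (1 / \<alpha>) * ln (real n) powr (2 + \<epsilon>))))) \<and>
    (p \<in> {0<..1} \<longrightarrow> (\<forall>\<^sub>F n in sequentially.
        \<psi> (ln (real n) powr (4 + \<epsilon>) / real n powr (1 / \<alpha>)) \<le> max_process \<alpha> \<psi> p n x \<and>
        max_process \<alpha> \<psi> p n x \<le> \<psi> (1 / (real n powr (1 / \<alpha>) * ln (real n) powr (2 + \<epsilon>)))))"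
      using upper near_0 near_pos by eventually_elim (auto simp: eventually_conj_iff)
  qed
qed

end
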